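(* Under conditions (C1) and (C2), the singular locus of the left ideal $\mathfrak I=D_m\ell_1+\cdots+D_m\ell_m$ (i.e. of the system $\mathcal F_C^{p,m}(a,B)$) is $$S(x)=\{x\in\mathbb C^m\mid x_1\cdots x_m R(x)=0\},$$ where $R(x)=\prod_{(i_1,\dots,i_m)\in\{1,\dots,p\}^m}\big(1-\zeta_p^{i_1}\sqrt[p]{x_1}-\cdots-\zeta_p^{i_m}\sqrt[p]{x_m}\big)$, a polynomial in $x_1,\dots,x_m$ of degree $p^{m-1}$, with $\zeta_p=\exp(2\pi\sqrt{-1}/p)$.
   Context: $D_m=\mathbb C\langle x_1,\dots,x_m,\partial_1,\dots,\partial_m\rangle$ is the Weyl algebra. For $a_1,\dots,a_p\in\mathbb C$, $b_{j,k}\in\mathbb C\setminus\{0,-1,-2,\dots\}$ ($1\le j\le p-1$), $b_{p,k}=1$, let $\ell_k=\prod_{i=1}^p(x_k\partial_k+b_{i,k}-1)-x_k\prod_{i=1}^p(\sum_{j=1}^m x_j\partial_j+a_i)$, $k=1,\dots,m$. Conditions: (C1) $a_i-\sum_{k=1}^m b_{j_k,k}\notin\mathbb Z$ for all $i$ and all $(j_1,\dots,j_m)\in\{1,\dots,p\}^m$; (C2) $b_{j,k}-b_{j',k}\notin\mathbb Z$ for $1\le j<j'\le p$. The initial ideal $\operatorname{in}(\mathfrak I)\subset\mathbb C[x,\xi]$ is the ideal of principal symbols (w.r.t. order filtration) of elements of $\mathfrak I$; the characteristic variety is $\operatorname{Ch}(\mathfrak I)=\{(x,\xi)\in\mathbb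 C^{2m}\mid L(x,\xi)=0\ \forall L\in\operatorname{in}(\mathfrak I)\}$; the singular locus is the Zariski closure of the projection to $x$-space of $\operatorname{Ch}(\mathfrak I)\setminus\{\xi=0\}$. *)

theory Defs
  imports "HOL-Analysis.Analysis" "HOL-Library.Poly_Mapping" "HOL-Library.FuncSet"
begin

type_synonym 'm mon = "'m \<Rightarrow>\<^sub>0 nat"
type_synonym 'm cpoly = "'m mon \<Rightarrow>\<^sub>0 complex"
(* Elements of the Weyl algebra in normally ordered form:
   c = \<Sum> c(\<alpha>,\<beta>) x^\<alpha> \<partial>^\<beta>  (finitely supported coefficients) *)
type_synonym 'm wcoeff = "('m mon \<times> 'm mon) \<Rightarrow>\<^sub>0 complex"
(* Operators on C[x]; D_m is realised by its (faithful) action on C[x] *)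
type_synonym 'm wop = "'m cpoly \<Rightarrow> 'm cpoly"

definition mdeg :: "'m mon \<Rightarrow> nat" where
  "mdeg \<alpha> = (\<Sum>i\<in>Poly_Mapping.keys \<alpha>. Poly_Mapping.lookup \<alpha> i)"

definition xmon :: "'m mon \<Rightarrow> 'm cpoly" where
  "xmon \<alpha> = Poly_Mapping.single \<alpha> 1"

definition const_poly :: "complex \<Rightarrow> 'm cpoly" where
  "const_poly c = Poly_Mapping.single 0 c"

definition dpow :: "'m mon \<Rightarrow> 'm cpoly \<Rightarrow> 'm cpoly" where
  "dpow \<beta> f = (\<Sum>\<alpha>\<in>Poly_Mapping.keys f. Poly_Mapping.single (\<alpha> - \<beta>)
      (Poly_Mapping.lookup f \<alpha> * of_nat (\<Prod>i\<in>Poly_Mapping.keys \<beta>. (Poly_Mapping.lookup \<alpha> i choose Poly_Mapping.lookup \<beta> i) * fact (Poly_Mapping.lookup \<beta> i))))"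

definition wop :: "'m wcoeff \<Rightarrow> 'm wop" where
  "wop c f = (\<Sum>(\<alpha>,\<beta>)\<in>Poly_Mapping.keys c. Poly_Mapping.single \<alpha> (Poly_Mapping.lookup c (\<alpha>,\<beta>)) * dpow \<beta> f)"

definition weyl :: "'m wop set" where
  "weyl = range wop"

definition left_ideal_gen :: "('m::finite \<Rightarrow> 'm wop) \<Rightarrow> 'm wop set" where
  "left_ideal_gen L = {(\<lambda>f. \<Sum>k\<in>UNIV. P k (L k f)) | P. \<forall>k. P k \<in> weyl}"

definition word :: "'m wcoeff \<Rightarrow> nat" where
  "word c = Max ((\<lambda>(\<alpha>,\<beta>). mdeg \<beta>) ` Poly_Mapping.keys c)"

definition psymbol :: "('m::finite) wcoeff \<Rightarrow> ('m \<Rightarrow> complex) \<Rightarrow> ('m \<Rightarrow> complex) \<Rightarrow> complex" where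
  "psymbol c x \<xi> = (\<Sum>(\<alpha>,\<beta>)\<in>{(\<alpha>,\<beta>)\<in>Poly_Mapping.keys c. mdeg \<beta> = word c}.
      Poly_Mapping.lookup c (\<alpha>,\<beta>) * (\<Prod>i\<in>UNIV. x i ^ Poly_Mapping.lookup \<alpha> i) * (\<Prod>i\<in>UNIV. \<xi> i ^ Poly_Mapping.lookup \<beta> i))"

definition char_variety :: "('m::finite) wop set \<Rightarrow> (('m \<Rightarrow> complex) \<times> ('m \<Rightarrow> complex)) set" where
  "char_variety I = {(x,\<xi>). \<forall>c. wop c \<in> I \<longrightarrow> psymbol c x \<xi> = 0}"

definition peval :: "('m::finite) cpoly \<Rightarrow> ('m \<Rightarrow> complex) \<Rightarrow> complex" where
  "peval q x = (\<Sum>\<alpha>\<in>Poly_Mapping.keys q. Poly_Mapping.lookup q \<alpha> * (\<Prod>i\<in>UNIV. x i ^ Poly_Mapping.lookup \<alpha> i))"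

definition pdeg :: "'m cpoly \<Rightarrow> nat" where
  "pdeg q = Max (insert 0 (mdeg ` Poly_Mapping.keys q))"

definition zariski_closure :: "(('m::finite) \<Rightarrow> complex) set \<Rightarrow> ('m \<Rightarrow> complex) set" where
  "zariski_closure A = {x. \<forall>q. (\<forall>y\<in>A. peval q y = 0) \<longrightarrow> peval q x = 0}"

definition sing_locus :: "('m::finite) wop set \<Rightarrow> ('m \<Rightarrow> complex) set" where
  "sing_locus I = zariski_closure (fst ` (char_variety I - {(x,\<xi>). \<xi> = (\<lambda>_. 0)}))"

definition comp_prod :: "(nat \<Rightarrow> 'a \<Rightarrow> 'a) \<Rightarrow> nat \<Rightarrow> 'a \<Rightarrow> 'a" where
  "comp_prod A p = foldr (\<lambda>i g. A i \<circ> g) [1..<p+1] id"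

definition euler :: "'m \<Rightarrow> 'm wop" where
  "euler k f = xmon (Poly_Mapping.single k 1) * dpow (Poly_Mapping.single k 1) f"

definition theta :: "('m::finite) wop" where
  "theta f = (\<Sum>j\<in>UNIV. euler j f)"

definition ell :: "(nat \<Rightarrow> complex) \<Rightarrow> (nat \<Rightarrow> ('m::finite) \<Rightarrow> complex) \<Rightarrow> nat \<Rightarrow> 'm \<Rightarrow> 'm wop" where
  "ell a b p k f =
     comp_prod (\<lambda>i g. euler k g + const_poly (b i k - 1) * g) p f
     - xmon (Poly_Mapping.single k 1) * comp_prod (\<lambda>i g. theta g + const_poly (a i) * g) p f"

definition zeta :: "nat \<Rightarrow> complex" where
  "zeta p = exp (2 * pi * \<i> / of_nat p)"

definition Rfun :: "nat \<Rightarrow> (('m::finite) \<Rightarrow> complex) \<Rightarrow> complex" where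
  "Rfun p x = (\<Prod>j\<in>(UNIV::'m set) \<rightarrow>\<^sub>E {1..p}.
      (1 - (\<Sum>k\<in>UNIV. zeta p ^ j k * x k powr (1 / of_nat p))))"

end

theory Submission
  imports Defs
begin

text \<open>The symbols of the \<open>\<ell>\<^sub>k\<close> give \<open>(x\<^sub>k \<xi>\<^sub>k)^p = x\<^sub>k s^p\<close> with \<open>s = \<Sum>\<^sub>j x\<^sub>j \<xi>\<^sub>j\<close>, so on the torus
  the \<open>x\<^sub>k \<xi>\<^sub>k / s\<close> are \<open>p\<close>-th roots of the \<open>x\<^sub>k\<close> with sum 1, i.e. \<open>R(x) = 0\<close>; this bounds the
  singular locus from above.

  For the converse, an operator \<open>P\<close> of the ideal annihilates the power series
  \<open>F = \<Sum> c\<^sub>n x^n\<close> with hypergeometric coefficients. The coefficient of \<open>x^n\<close> in \<open>P F\<close> is a finite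
  combination of the \<open>c\<^sub>m\<close> with \<open>m\<close> near \<open>n\<close>. As \<open>n = t \<eta>\<close>, \<open>t \<rightarrow> \<infinity>\<close>, the quotients
  \<open>c\<^sub>n / c\<^sub>m\<close> converge to \<open>x^(m - n)\<close> with \<open>x\<^sub>k = (\<eta>\<^sub>k / \<Sum>\<eta>)^p\<close>, and the leading term is the
  principal symbol of \<open>P\<close> at \<open>x\<^sub>k\<close>, \<open>\<xi>\<^sub>k = \<eta>\<^sub>k / x\<^sub>k\<close>. These points are Zariski dense in \<open>R = 0\<close>.

  At \<open>x\<^sub>\<kappa> = 0\<close> one uses series starting with \<open>x\<^sub>\<kappa>^N\<close>. These are solutions up to a multiple of
  \<open>A\<^sub>\<kappa>(N) = \<Prod>\<^sub>i (N + b\<^sub>i\<^sub>,\<^sub>\<kappa> - 1)\<close>, and all relations are polynomial in \<open>N\<close>, so \<open>N\<close> may be set to the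
  root 0 of \<open>A\<^sub>\<kappa>\<close> after division by the falling factorial \<open>N (N - 1) \<cdots> (N - d + 1)\<close>, where \<open>d\<close> is
  the order of \<open>P\<close>. This plays the role of a logarithmic solution, and shows that the symbol
  vanishes on the conormal bundle of the hyperplane.\<close>

section \<open>Power series action of the Weyl algebra\<close>

abbreviation lk :: "('k \<Rightarrow>\<^sub>0 'v::zero) \<Rightarrow> 'k \<Rightarrow> 'v" where
  "lk \<equiv> Poly_Mapping.lookup"

lemma poly_mapping_sum_singles:
  "f = (\<Sum>k\<in>Poly_Mapping.keys f. Poly_Mapping.single k (lk f k))"
  by (rule poly_mapping_eqI)
    (auto simp: lookup_sum lookup_single when_def in_keys_iff)

lemma sum_keys_single:
  assumes "\<phi> k 0 = 0"
  shows "(\<Sum>i\<in>Poly_Mapping.keys (Poly_Mapping.single k v). \<phi> i (lk (Poly_Mapping.single k v) i)) = \<phi> k v"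
  using assms by (cases "v = 0") auto

lemma mon_add_diff: "\<alpha> + (n - \<alpha>) = n \<longleftrightarrow> (\<forall>i. lk \<alpha> i \<le> lk n i)" for \<alpha> n :: "'m mon"
  by (simp add: poly_mapping_eq_iff fun_eq_iff lookup_add lookup_minus)
    (metis le_add1 le_add_diff_inverse)

lemma lookup_single_times:
  fixes \<alpha> n :: "'m mon" and g :: "'m cpoly"
  shows "lk (Poly_Mapping.single \<alpha> v * g) n = (if \<alpha> + (n - \<alpha>) = n then v * lk g (n - \<alpha>) else 0)"
proof -
  have "Poly_Mapping.single \<alpha> v * g
      = (\<Sum>k\<in>Poly_Mapping.keys g. Poly_Mapping.single (\<alpha> + k) (v * lk g k))"
    by (subst poly_mapping_sum_singles[of g]) (simp add: sum_distrib_left mult_single)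
  then have eq: "lk (Poly_Mapping.single \<alpha> v * g) n
      = (\<Sum>k\<in>Poly_Mapping.keys g. v * lk g k when \<alpha> + k = n)"
    by (simp add: lookup_sum lookup_single)
  show ?thesis
  proof (cases "\<alpha> + (n - \<alpha>) = n")
    case True
    have "(\<alpha> + k = n) = (k = n - \<alpha>)" for k
      using True by (metis add_diff_cancel_left')
    then show ?thesis using True
      by (auto simp: eq when_def in_keys_iff)
  next
    case False
    then have "\<alpha> + k \<noteq> n" for k
      by auto
    then show ?thesis using False by (simp add: eq)
  qed
qed

lemma lookup_const_poly_times: "lk (const_poly c * g) n = c * lk g n"
  unfolding const_poly_def by (simp add: lookup_single_times)

text \<open>The scalar in \<open>\<partial>^\<beta> x^\<gamma> = mfalling \<beta> \<gamma>
  x^(\<gamma> - \<beta>)\<close>. With complex factors it vanishes as soon as some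
  \<open>lk \<gamma> i < lk \<beta> i\<close>, and it can be read as a polynomial in the
  exponents.\<close>

definition mfalling :: "'m::finite mon \<Rightarrow> 'm mon \<Rightarrow> complex" where
  "mfalling \<beta> \<gamma> = (\<Prod>i\<in>UNIV. \<Prod>j<lk \<beta> i. of_nat (lk \<gamma> i) - of_nat j)"

lemma of_nat_choose_fact:
  "of_nat ((n choose k) * fact k) = (\<Prod>j<k. of_nat n - of_nat j :: complex)"
proof -
  have "(\<Prod>j<k. of_nat n - of_nat j :: complex) = (of_nat n gchoose k) * fact k"
    by (simp add: gbinomial_prod_rev atLeast0LessThan)
  also have "\<dots> = of_nat (n choose k) * fact k"
    by (simp add: binomial_gbinomial)
  finally show ?thesis by simp
qed

lemma mfalling_altdef:
  "of_nat (\<Prod>i\<in>Poly_Mapping.keys \<beta>. (lk \<gamma> i choose lk \<beta> i) * fact (lk \<beta> i)) = mfalling \<beta> \<gamma>"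
proof -
  have "mfalling \<beta> \<gamma> = (\<Prod>i\<in>UNIV. of_nat ((lk \<gamma> i choose lk \<beta> i) * fact (lk \<beta> i)))"
    unfolding mfalling_def of_nat_choose_fact ..
  also have "\<dots> = (\<Prod>i\<in>Poly_Mapping.keys \<beta>. of_nat ((lk \<gamma> i choose lk \<beta> i) * fact (lk \<beta> i)))"
    by (rule prod.mono_neutral_right) (auto simp: in_keys_iff)
  finally show ?thesis by simp
qed

lemma mfalling_eq_0:
  assumes "lk \<gamma> i < lk \<beta> i"
  shows "mfalling \<beta> \<gamma> = 0"
  unfolding mfalling_def using assms by (auto intro!: prod_zero bexI[of _ i])

lemma lookup_dpow:
  fixes \<beta> n :: "'m::finite mon"
  shows "lk (dpow \<beta> f) n = mfalling \<beta> (n + \<beta>) * lk f (n + \<beta>)"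
proof -
  have "lk (dpow \<beta> f) n
      = (\<Sum>\<alpha>\<in>Poly_Mapping.keys f. lk f \<alpha> * mfalling \<beta> \<alpha> when \<alpha> - \<beta> = n)"
    unfolding dpow_def mfalling_altdef by (simp add: lookup_sum lookup_single)
  also have "\<dots> = (\<Sum>\<alpha>\<in>Poly_Mapping.keys f. lk f \<alpha> * mfalling \<beta> \<alpha> when \<alpha> = n + \<beta>)"
  proof (rule sum.cong[OF refl])
    fix \<alpha> assume "\<alpha> \<in> Poly_Mapping.keys f"
    show "(lk f \<alpha> * mfalling \<beta> \<alpha> when \<alpha> - \<beta> = n) = (lk f \<alpha> * mfalling \<beta> \<alpha> when \<alpha> = n + \<beta>)"
    proof (cases "\<forall>i. lk \<beta> i \<le> lk \<alpha> i")
      case True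
      then have "\<beta> + (\<alpha> - \<beta>) = \<alpha>"
        by (simp add: mon_add_diff)
      then have "(\<alpha> - \<beta> = n) = (\<alpha> = n + \<beta>)"
        by (metis add.commute add_diff_cancel_right')
      then show ?thesis by simp
    next
      case False
      \<comment> \<open>Truncated subtraction may still give \<open>\<alpha> - \<beta> = n\<close>
        here, but such a term carries a vanishing falling factorial.\<close>
      then show ?thesis using mfalling_eq_0 by (auto simp: not_le when_def)
    qed
  qed
  also have "\<dots> = mfalling \<beta> (n + \<beta>) * lk f (n + \<beta>)"
    by (auto simp: when_def in_keys_iff sum.delta)
  finally show ?thesis .
qed

text \<open>Formal power series are represented by their coefficient functions. The condition
  \<open>\<alpha> + (n - \<alpha>) = n\<close> says \<open>\<alpha> \<le> n\<close> componentwise, as subtraction of exponents is truncated.\<close>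

definition wact :: "'m::finite wcoeff \<Rightarrow> ('m mon \<Rightarrow> complex) \<Rightarrow> 'm mon \<Rightarrow> complex" where
  "wact c F n = (\<Sum>(\<alpha>,\<beta>)\<in>Poly_Mapping.keys c. if \<alpha> + (n - \<alpha>) = n
      then lk c (\<alpha>,\<beta>) * mfalling \<beta> (n - \<alpha> + \<beta>) * F (n - \<alpha> + \<beta>) else 0)"

lemma lookup_wop: "lk (wop c f) n = wact c (lk f) n"
  unfolding wop_def wact_def lookup_sum
  by (intro sum.cong refl) (auto simp: lookup_single_times lookup_dpow)

lemma mdeg_UNIV: "mdeg \<alpha> = (\<Sum>i\<in>UNIV. lk \<alpha> i)" for \<alpha> :: "'m::finite mon"
  unfolding mdeg_def by (rule sum.mono_neutral_left) (auto simp: in_keys_iff)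

lemma mdeg_add: "mdeg (\<alpha> + \<beta>) = mdeg \<alpha> + mdeg \<beta>" for \<alpha> :: "'m::finite mon"
  by (simp add: mdeg_UNIV lookup_add sum.distrib)

lemma mdeg_single [simp]: "mdeg (Poly_Mapping.single k n) = n" 
  by (simp add: mdeg_def)

section \<open>Action of the generators on coefficient functions\<close>

lemma mfalling_single:
  "mfalling (Poly_Mapping.single k d) \<gamma> = (\<Prod>j<d. of_nat (lk \<gamma> k) - of_nat j)"
proof -
  have "mfalling (Poly_Mapping.single k d) \<gamma>
     = (\<Prod>i\<in>UNIV. if i = k then (\<Prod>j<d. of_nat (lk \<gamma> k) - of_nat j) else 1)"
    unfolding mfalling_def by (intro prod.cong) (auto simp: lookup_single when_def)
  then show ?thesis by (simp add: prod.delta)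
qed

lemma lookup_euler: "lk (euler k f) n = of_nat (lk n k) * lk f n" for n :: "'m::finite mon"
proof (cases "Poly_Mapping.single k 1 + (n - Poly_Mapping.single k 1) = n")
  case True
  then have "n - Poly_Mapping.single k 1 + Poly_Mapping.single k 1 = n"
    by (simp add: add.commute)
  then have "lk (dpow (Poly_Mapping.single k 1) f) (n - Poly_Mapping.single k 1) = of_nat (lk n k) * lk f n"
    unfolding lookup_dpow by (simp add: mfalling_single)
  then show ?thesis
    unfolding euler_def xmon_def lookup_single_times using True by simp
next
  case False
  then have "lk n k = 0" 
    by (auto simp: mon_add_diff lookup_single when_def not_le split: if_splits)
  with False show ?thesis
    by (simp add: euler_def xmon_def lookup_single_times)
qed

lemma lookup_theta: "lk (theta f) n = of_nat (mdeg n) * lk f n"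
  by (simp add: theta_def lookup_sum lookup_euler mdeg_UNIV sum_distrib_right)

lemma comp_prod_Suc: "comp_prod A (Suc p) = comp_prod A p \<circ> A (Suc p)"
proof -
  have "foldr (\<lambda>i g. A i \<circ> g) xs h = foldr (\<lambda>i g. A i \<circ> g) xs id \<circ> h" for xs h
    by (induction xs) (auto simp: o_assoc)
  from this[of "[1..<p+1]" "A (Suc p)"] show ?thesis 
    by (simp add: comp_prod_def)
qed

lemma comp_prod_0: "comp_prod A 0 = id"
  by (simp add: comp_prod_def)

text \<open>Operators that are diagonal on monomials compose by multiplying eigenvalues; this turns
  \<open>ell\<close> into a two-term recursion on coefficients.\<close>

lemma lookup_comp_prod:
  assumes "\<And>i g. lk (A i g) n = ev i * lk g n"
  shows "lk (comp_prod A p g) n = (\<Prod>i=1..p. ev i) * lk g n"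
proof (induction p arbitrary: g)
  case 0
  then show ?case by (simp add: comp_prod_0)
next
  case (Suc p)
  then show ?case using assms by (simp add: comp_prod_Suc mult.assoc)
qed

text \<open>Together with \<open>Apol\<close>, the eigenvalues of the two operator products in
  \<open>ell\<close>. The argument is complex because it later becomes a polynomial
  variable.\<close>

definition Bpol :: "(nat \<Rightarrow> complex) \<Rightarrow> nat \<Rightarrow> complex \<Rightarrow> complex" where
  "Bpol a p z = (\<Prod>i=1..p. z + a i)"

definition Apol :: "(nat \<Rightarrow> 'm \<Rightarrow> complex) \<Rightarrow> nat \<Rightarrow> 'm \<Rightarrow> complex \<Rightarrow> complex" where
  "Apol b p k z = (\<Prod>i=1..p. z + (b i k - 1))"

text \<open>The second summand is read one step below \<open>n\<close>, in degree
  \<open>mdeg n - 1\<close>, because of the factor \<open>x_k\<close> in front of the second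
  product.\<close>

definition ellact :: "(nat \<Rightarrow> complex) \<Rightarrow> (nat \<Rightarrow> 'm::finite \<Rightarrow> complex) \<Rightarrow> nat \<Rightarrow> 'm \<Rightarrow> ('m mon \<Rightarrow> complex) \<Rightarrow> 'm mon \<Rightarrow> complex" where
  "ellact a b p k F n = Apol b p k (of_nat (lk n k)) * F n
     - (if 0 < lk n k then Bpol a p (of_nat (mdeg n - 1)) * F (n - Poly_Mapping.single k 1) else 0)"

lemma mon_diff_single_iff: "Poly_Mapping.single k 1 + (n - Poly_Mapping.single k 1) = n \<longleftrightarrow> 0 < lk n k"
  for n :: "'m mon"
  by (auto simp: mon_add_diff lookup_single when_def)

lemma mdeg_diff_single: 
  fixes n :: "'m::finite mon"
  assumes "0 < lk n k"
  shows "mdeg (n - Poly_Mapping.single k (Suc 0)) = mdeg n - Suc 0"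
  using mdeg_add[of "Poly_Mapping.single k (Suc 0)" "n - Poly_Mapping.single k (Suc 0)"] assms
    mon_diff_single_iff[of k n] by simp

lemma lookup_ell: "lk (ell a b p k f) n = ellact a b p k (lk f) n"
proof -
  have 1: "lk (comp_prod (\<lambda>i g. euler k g + const_poly (b i k - 1) * g) p f) n
    = Apol b p k (of_nat (lk n k)) * lk f n"
    unfolding Apol_def
    by (rule lookup_comp_prod) (simp add: lookup_add lookup_euler lookup_const_poly_times ring_distribs)
  have 2: "lk (comp_prod (\<lambda>i g. theta g + const_poly (a i) * g) p f) n
    = Bpol a p (of_nat (mdeg n)) * lk f n" for n
    unfolding Bpol_def
    by (rule lookup_comp_prod) (simp add: lookup_add lookup_theta lookup_const_poly_times ring_distribs)
  show ?thesis
    unfolding ell_def lookup_minus 1 xmon_def lookup_single_times 2 ellact_def mon_diff_single_iff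
    by (simp add: mdeg_diff_single)
qed

section \<open>From polynomials to power series\<close>

lemma finite_mdeg_le: "finite {n :: 'm::finite mon. mdeg n \<le> T}"
proof -
  have "inj_on lk {n :: 'm mon. mdeg n \<le> T}"
    by (rule inj_onI, rule poly_mapping_eqI) simp
  moreover have "lk ` {n :: 'm mon. mdeg n \<le> T} \<subseteq> UNIV \<rightarrow>\<^sub>E {..T}"
  proof
    fix g assume "g \<in> lk ` {n :: 'm mon. mdeg n \<le> T}"
    then obtain n :: "'m mon" where n: "g = lk n" "mdeg n \<le> T" by blast
    have "lk n i \<le> T" for i
      using member_le_sum[of i UNIV "lk n"] n(2) by (simp add: mdeg_UNIV)
    then show "g \<in> UNIV \<rightarrow>\<^sub>E {..T}" using n(1) by auto
  qed
  moreover have "finite ((UNIV :: 'm set) \<rightarrow>\<^sub>E {..T})"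
    by (intro finite_PiE) auto
  ultimately show ?thesis
    using finite_imageD finite_subset by blast
qed

lemma exists_truncation:
  fixes F :: "'m::finite mon \<Rightarrow> complex"
  obtains f :: "'m cpoly" where "\<And>n. mdeg n \<le> T \<Longrightarrow> lk f n = F n"
proof -
  have "finite {n. (if mdeg n \<le> T then F n else 0) \<noteq> 0}"
    by (rule finite_subset[OF _ finite_mdeg_le[of T]]) auto
  then have "lk (Abs_poly_mapping (\<lambda>n. if mdeg n \<le> T then F n else 0)) n = F n" if "mdeg n \<le> T" for n
    using that by simp
  then show ?thesis using that by blast
qed

lemma mdeg_shift_le:
  fixes \<alpha> \<beta> n :: "'m::finite mon"
  shows "mdeg (n - \<alpha> + \<beta>) \<le> mdeg n + mdeg \<beta>"
  by (simp add: mdeg_UNIV lookup_add lookup_minus sum.distrib sum_mono)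

lemma wact_cong:
  assumes "\<And>\<alpha> \<beta>. (\<alpha>,\<beta>) \<in> Poly_Mapping.keys c \<Longrightarrow> F (n - \<alpha> + \<beta>) = G (n - \<alpha> + \<beta>)"
  shows "wact c F n = wact c G n"
  unfolding wact_def using assms by (intro sum.cong) auto

text \<open>Multiplication by \<open>x^\<alpha>\<close> only lowers the exponents that are read, and
  \<open>\<partial>^\<beta>\<close> raises their degree by at most \<open>mdeg \<beta>\<close>; so
  the order of the operator serves as \<open>D\<close>.\<close>

lemma wact_local:
  fixes c :: "'m::finite wcoeff"
  obtains D where "\<And>F G n. (\<And>m. mdeg m \<le> mdeg n + D \<Longrightarrow> F m = G m) \<Longrightarrow> wact c F n = wact c G n"
proof -
  define D where "D = Max (insert 0 ((\<lambda>(\<alpha>,\<beta>). mdeg \<beta>) ` Poly_Mapping.keys c))"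
  have D: "mdeg \<beta> \<le> D" if "(\<alpha>,\<beta>) \<in> Poly_Mapping.keys c" for \<alpha> \<beta>
    unfolding D_def using that by (intro Max_ge) force+
  have "wact c F n = wact c G n" if "\<And>m. mdeg m \<le> mdeg n + D \<Longrightarrow> F m = G m" for F G n
  proof (rule wact_cong, rule that)
    fix \<alpha> \<beta> assume "(\<alpha>,\<beta>) \<in> Poly_Mapping.keys c"
    with D have "mdeg \<beta> \<le> D" by blast
    with mdeg_shift_le[of n \<alpha> \<beta>] show "mdeg (n - \<alpha> + \<beta>) \<le> mdeg n + D" by linarith
  qed
  then show ?thesis using that by blast
qed

text \<open>Membership in the ideal is an identity of operators on polynomials; it extends to power series
  because every coefficient of the result depends on finitely many coefficients of \<open>F\<close>.\<close>

lemma wact_ell_combination: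
  fixes F :: "'m::finite mon \<Rightarrow> complex"
  assumes "\<And>f. wop c f = (\<Sum>k\<in>UNIV. wop (C k) (ell a b p k f))"
  shows "wact c F n = (\<Sum>k\<in>UNIV. wact (C k) (ellact a b p k F) n)"
proof -
  obtain D where D: "\<And>F G n. (\<And>m. mdeg m \<le> mdeg n + D \<Longrightarrow> F m = G m) \<Longrightarrow> wact c F n = wact c G n"
    using wact_local by blast
  have "\<forall>k. \<exists>D. \<forall>F G n. (\<forall>m. mdeg m \<le> mdeg n + D \<longrightarrow> F m = G m) \<longrightarrow> wact (C k) F n = wact (C k) G n"
    using wact_local by metis
  then obtain E where E: "\<And>k F G n. (\<And>m. mdeg m \<le> mdeg n + E k \<Longrightarrow> F m = G m) \<Longrightarrow> wact (C k) F n = wact (C k) G n"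
    by metis
  \<comment> \<open>Large enough for \<open>wact c\<close> and for every \<open>wact (C k)\<close>
    at \<open>n\<close>; \<open>ellact\<close> reads its argument only in degrees up to that of its
    output.\<close>
  define T where "T = mdeg n + D + (\<Sum>k\<in>UNIV. E k)"
  obtain f :: "'m cpoly" where f: "\<And>n. mdeg n \<le> T \<Longrightarrow> lk f n = F n"
    using exists_truncation by blast
  have "wact c F n = wact c (lk f) n"
    by (rule D) (auto simp: f T_def)
  also have "\<dots> = (\<Sum>k\<in>UNIV. wact (C k) (lk (ell a b p k f)) n)"
    by (simp add: lookup_wop[symmetric] assms lookup_sum)
  also have "\<dots> = (\<Sum>k\<in>UNIV. wact (C k) (ellact a b p k F) n)"
  proof (rule sum.cong[OF refl], rule E)
    fix k :: 'm and m :: "'m mon" assume m: "mdeg m \<le> mdeg n + E k"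
    have "E k \<le> (\<Sum>k\<in>UNIV. E k)" by (simp add: member_le_sum)
    with m have "mdeg m \<le> T" by (simp add: T_def)
    moreover have "mdeg (m - Poly_Mapping.single k 1) \<le> mdeg m"
      by (simp add: mdeg_UNIV lookup_minus sum_mono)
    ultimately show "lk (ell a b p k f) m = ellact a b p k F m"
      by (simp add: lookup_ell ellact_def f)
  qed
  finally show ?thesis .
qed

text \<open>The form in which the hypothesis of ideal membership is exploited below;
  \<open>C\<close> holds the cofactors in normally ordered form.\<close>

lemma left_ideal_gen_wact:
  fixes c :: "'m::finite wcoeff"
  assumes "wop c \<in> left_ideal_gen (ell a b p)"
  obtains C where "\<And>F n. wact c F n = (\<Sum>k\<in>UNIV. wact (C k) (ellact a b p k F) n)"
proof -
  from assms obtain P where P: "wop c = (\<lambda>f. \<Sum>k\<in>UNIV. P k (ell a b p k f))" "\<forall>k. P k \<in> weyl"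
    unfolding left_ideal_gen_def by auto
  from P(2) have "\<forall>k. \<exists>d. P k = wop d" by (auto simp: weyl_def)
  then obtain C where "\<And>k. P k = wop (C k)" by metis
  with P(1) have "wop c f = (\<Sum>k\<in>UNIV. wop (C k) (ell a b p k f))" for f
    by simp
  from wact_ell_combination[OF this] that show ?thesis by blast
qed

section \<open>The hypergeometric series and the characteristic variety over the torus\<close>

text \<open>The hypergeometric series whose exponents start at \<open>N\<close> in direction \<open>\<kappa>\<close> and at 0 in the other
  directions. For \<open>N = 0\<close> it does not depend on \<open>\<kappa>\<close> and is annihilated by all \<open>\<ell>\<^sub>k\<close>.\<close>

definition hyp :: "(nat \<Rightarrow> complex) \<Rightarrow> (nat \<Rightarrow> 'm::finite \<Rightarrow> complex) \<Rightarrow> nat \<Rightarrow> 'm \<Rightarrow> nat \<Rightarrow> 'm mon \<Rightarrow> complex" where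
  "hyp a b p \<kappa> N n = (if lk n \<kappa> < N then 0 else
     (\<Prod>j=N..<mdeg n. Bpol a p (of_nat j)) /
     (\<Prod>k\<in>UNIV. \<Prod>j\<in>{(if k = \<kappa> then N else 0)<..lk n k}. Apol b p k (of_nat j)))"

text \<open>The factor with \<open>i = p\<close> is \<open>z\<close>, by the normalisation of
  \<open>b p k\<close>. Thus 0 is an admissible starting exponent in every direction.\<close>

lemma Apol_0:
  assumes "1 \<le> p" "\<forall>k. b p k = 1"
  shows "Apol b p k 0 = 0"
  unfolding Apol_def using assms by (auto intro!: prod_zero bexI[of _ p])

lemma Apol_nonzero:
  assumes "\<forall>j k. 1 \<le> j \<and> j \<le> p - 1 \<longrightarrow> (\<forall>n::nat. b j k \<noteq> - of_nat n)" "\<forall>k. b p k = 1" "0 < n"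
  shows "Apol b p k (of_nat n) \<noteq> 0"
proof
  assume "Apol b p k (of_nat n) = 0"
  then obtain i where i: "i \<in> {1..p}" "of_nat n + (b i k - 1) = 0"
    unfolding Apol_def by auto
  then have bi: "b i k = - of_nat (n - 1)"
    using \<open>0 < n\<close> by (simp add: of_nat_diff algebra_simps eq_neg_iff_add_eq_0)
  show False
  proof (cases "i = p")
    case True
    then have "of_nat n = (0::complex)" using i(2) assms(2) by simp
    then show False using \<open>0 < n\<close> by simp
  next
    case False
    then show False using i(1) bi assms(1) by auto
  qed
qed

lemma Bpol_nonzero:
  assumes "\<forall>i\<in>{1..p}. a i \<notin> \<int>"
  shows "Bpol a p (of_nat n) \<noteq> 0"
proof
  assume "Bpol a p (of_nat n) = 0"
  then obtain i where i: "i \<in> {1..p}" "of_nat n + a i = 0"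
    unfolding Bpol_def by auto
  then have "a i = - of_nat n" by (simp add: add_eq_0_iff2)
  then have "a i \<in> \<int>" by simp
  with assms i(1) show False by blast
qed

text \<open>Numerator and denominator each gain exactly one factor. If the exponent of
  \<open>n\<close> in direction \<open>\<kappa>\<close> is below \<open>N\<close>, then
  \<open>k \<noteq> \<kappa>\<close> and both sides vanish.\<close>

lemma hyp_step:
  assumes A: "\<And>k j. 0 < j \<Longrightarrow> Apol b p k (of_nat j) \<noteq> 0"
    and "(if k = \<kappa> then N else 0) \<le> lk n k"
  shows "Apol b p k (of_nat (Suc (lk n k))) * hyp a b p \<kappa> N (n + Poly_Mapping.single k 1)
     = Bpol a p (of_nat (mdeg n)) * hyp a b p \<kappa> N n"
proof (cases "lk n \<kappa> < N")
  case True
  with assms(2) have "k \<noteq> \<kappa>" by auto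
  with True show ?thesis by (simp add: hyp_def lookup_add lookup_single)
next
  case False
  define D where "D = (\<lambda>n k'. \<Prod>j\<in>{(if k' = \<kappa> then N else 0)<..n}. Apol b p k' (of_nat j))"
  have "lk n \<kappa> \<le> mdeg n" by (simp add: mdeg_UNIV member_le_sum)
  with False have N: "N \<le> mdeg n" by simp
  have hyp_n: "hyp a b p \<kappa> N n = (\<Prod>j=N..<mdeg n. Bpol a p (of_nat j)) / (\<Prod>k\<in>UNIV. D (lk n k) k)"
    using False by (simp add: hyp_def D_def)
  have "hyp a b p \<kappa> N (n + Poly_Mapping.single k 1)
    = (\<Prod>j=N..<Suc (mdeg n). Bpol a p (of_nat j)) / (\<Prod>k'\<in>UNIV. D (lk (n + Poly_Mapping.single k 1) k') k')"
    using False by (simp add: hyp_def D_def mdeg_add lookup_add)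
  also have "(\<Prod>k'\<in>UNIV. D (lk (n + Poly_Mapping.single k 1) k') k')
     = D (Suc (lk n k)) k * (\<Prod>k'\<in>UNIV - {k}. D (lk n k') k')"
    by (subst prod.remove[of _ k]) (auto simp: lookup_add lookup_single intro!: prod.cong)
  also have "{(if k = \<kappa> then N else 0)<..Suc (lk n k)} = insert (Suc (lk n k)) {(if k = \<kappa> then N else 0)<..lk n k}"
    using assms(2) by auto
  then have "D (Suc (lk n k)) k = Apol b p k (of_nat (Suc (lk n k))) * D (lk n k) k"
    unfolding D_def by simp
  also have "\<dots> * (\<Prod>k'\<in>UNIV - {k}. D (lk n k') k') = Apol b p k (of_nat (Suc (lk n k))) * (\<Prod>k\<in>UNIV. D (lk n k) k)"
    by (subst (2) prod.remove[of _ k]) auto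
  finally show ?thesis using N A[of "Suc (lk n k)" k] unfolding hyp_n by simp
qed

text \<open>By \<open>hyp_step\<close> the two terms of the recursion cancel above the starting
  exponent. On the starting layer there is no predecessor, so the eigenvalue \<open>Apol\<close>
  remains; for \<open>k \<noteq> \<kappa>\<close> the starting exponent is 0 and this eigenvalue is
  zero.\<close>

lemma ellact_hyp:
  assumes A: "\<And>k j. 0 < j \<Longrightarrow> Apol b p k (of_nat j) \<noteq> 0" and A0: "\<And>k. Apol b p k 0 = 0"
  shows "ellact a b p k (hyp a b p \<kappa> N) n
    = (if k = \<kappa> \<and> lk n \<kappa> = N then Apol b p \<kappa> (of_nat N) * hyp a b p \<kappa> N n else 0)"
proof (cases "(if k = \<kappa> then N else 0) < lk n k")
  case True
  define m where "m = n - Poly_Mapping.single k 1"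
  have n: "n = m + Poly_Mapping.single k 1"
    using True mon_diff_single_iff[of k n] unfolding m_def by (metis add.commute gr_zeroI not_less_zero)
  have "(if k = \<kappa> then N else 0) \<le> lk m k"
    using True unfolding n lookup_add by simp
  from hyp_step[OF A this, of a] True show ?thesis
    unfolding ellact_def m_def[symmetric] by (auto simp: n mdeg_add lookup_add)
next
  case False
  show ?thesis
  proof (cases "k = \<kappa>")
    case True
    have "hyp a b p \<kappa> N (n - Poly_Mapping.single k 1) = 0" if "0 < lk n k"
      using that False True by (simp add: hyp_def lookup_minus)
    moreover have "hyp a b p \<kappa> N n = 0" if "lk n \<kappa> \<noteq> N"
      using that False True by (simp add: hyp_def)
    ultimately show ?thesis using True False by (auto simp: ellact_def)
  next
    case kne: False
    with False show ?thesis by (simp add: ellact_def A0)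
  qed
qed

lemma hyp_nonzero:
  assumes "\<And>k j. 0 < j \<Longrightarrow> Apol b p k (of_nat j) \<noteq> 0" "\<And>j. Bpol a p (of_nat j) \<noteq> 0" "N \<le> lk n \<kappa>"
  shows "hyp a b p \<kappa> N n \<noteq> 0"
  using assms by (auto simp: hyp_def)

section \<open>Asymptotics of the hypergeometric coefficients\<close>

definition mon_of :: "('m::finite \<Rightarrow> nat) \<Rightarrow> 'm mon" where
  "mon_of f = Abs_poly_mapping f"

lemma lookup_mon_of [simp]: "lk (mon_of f) = f"
  by (simp add: mon_of_def)

text \<open>The constant shifts \<open>e i\<close> disappear after division by \<open>t\<close>, so
  the parameters \<open>a\<close> and \<open>b\<close> leave no trace in the limits below.\<close>

lemma tendsto_prod_shift:
  fixes z :: "nat \<Rightarrow> complex"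
  assumes "(\<lambda>t. z t / of_nat t) \<longlonglongrightarrow> w"
  shows "(\<lambda>t. (\<Prod>i=1..p. z t + e i) / of_nat t ^ p) \<longlonglongrightarrow> w ^ p"
proof -
  have "(\<lambda>t. \<Prod>i=1..p. z t / of_nat t + e i / of_nat t) \<longlonglongrightarrow> (\<Prod>i=1..p. w + 0)"
    by (intro tendsto_prod tendsto_add assms lim_const_over_n)
  then show ?thesis
    by (simp add: add_divide_distrib[symmetric] prod_dividef)
qed

text \<open>By \<open>hyp_step\<close> the ratio is a value of \<open>Bpol\<close> over a value of
  \<open>Apol\<close>, and both are asymptotic to a constant times \<open>t^p\<close> along the path
  \<open>n\<close>.\<close>

lemma hyp_ratio_single:
  fixes n :: "nat \<Rightarrow> 'm::finite mon" and \<eta> :: "'m \<Rightarrow> complex"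
  assumes A: "\<And>k j. 0 < j \<Longrightarrow> Apol b p k (of_nat j) \<noteq> 0"
    and B: "\<And>j. Bpol a p (of_nat j) \<noteq> 0"
    and n: "\<And>i. (\<lambda>t. of_nat (lk (n t) i) / of_nat t) \<longlonglongrightarrow> \<eta> i" and \<eta>: "\<eta> k \<noteq> 0"
  shows "(\<lambda>t. hyp a b p \<kappa> 0 (n t + Poly_Mapping.single k 1) / hyp a b p \<kappa> 0 (n t))
     \<longlonglongrightarrow> ((\<Sum>i\<in>UNIV. \<eta> i) / \<eta> k) ^ p"
proof -
  have eq: "hyp a b p \<kappa> 0 (n t + Poly_Mapping.single k 1) / hyp a b p \<kappa> 0 (n t)
     = (Bpol a p (of_nat (mdeg (n t))) / of_nat t ^ p) / (Apol b p k (of_nat (Suc (lk (n t) k))) / of_nat t ^ p)"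
    if "t > 0" for t
    using hyp_step[OF A, of k \<kappa> 0 "n t" a] hyp_nonzero[OF A B, of 0 "n t" \<kappa>] A[of "Suc (lk (n t) k)" k] that
    by (simp add: field_simps)
  have "(\<lambda>t. of_nat (mdeg (n t)) / of_nat t) \<longlonglongrightarrow> (\<Sum>i\<in>UNIV. \<eta> i)"
    using tendsto_sum[of UNIV "\<lambda>i t. of_nat (lk (n t) i) / of_nat t :: complex" \<eta>] n
    by (simp add: mdeg_UNIV sum_divide_distrib)
  then have 1: "(\<lambda>t. Bpol a p (of_nat (mdeg (n t))) / of_nat t ^ p) \<longlonglongrightarrow> (\<Sum>i\<in>UNIV. \<eta> i) ^ p"
    unfolding Bpol_def by (rule tendsto_prod_shift)
  have "(\<lambda>t. of_nat (lk (n t) k) / of_nat t + 1 / of_nat t) \<longlonglongrightarrow> \<eta> k + 0"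
    by (intro tendsto_add n lim_const_over_n)
  then have "(\<lambda>t. of_nat (Suc (lk (n t) k)) / of_nat t) \<longlonglongrightarrow> \<eta> k"
    by (simp add: add_divide_distrib add.commute)
  then have 2: "(\<lambda>t. Apol b p k (of_nat (Suc (lk (n t) k))) / of_nat t ^ p) \<longlonglongrightarrow> \<eta> k ^ p"
    unfolding Apol_def by (rule tendsto_prod_shift)
  have "(\<lambda>t. (Bpol a p (of_nat (mdeg (n t))) / of_nat t ^ p) / (Apol b p k (of_nat (Suc (lk (n t) k))) / of_nat t ^ p))
     \<longlonglongrightarrow> (\<Sum>i\<in>UNIV. \<eta> i) ^ p / \<eta> k ^ p"
    using \<eta> by (intro tendsto_divide 1 2) simp
  then have "(\<lambda>t. (Bpol a p (of_nat (mdeg (n t))) / of_nat t ^ p) / (Apol b p k (of_nat (Suc (lk (n t) k))) / of_nat t ^ p))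
     \<longlonglongrightarrow> ((\<Sum>i\<in>UNIV. \<eta> i) / \<eta> k) ^ p"
    by (simp add: power_divide)
  then show ?thesis
    by (rule Lim_transform_eventually) (use eq in \<open>auto intro: eventually_mono[OF eventually_gt_at_top[of 0]]\<close>)
qed

text \<open>Split \<open>\<mu>\<close> into unit steps and multiply the limits: a bounded shift of
  the path \<open>n\<close> does not change its direction \<open>\<eta>\<close>.\<close>

lemma hyp_ratio:
  fixes n :: "nat \<Rightarrow> 'm::finite mon" and \<eta> :: "'m \<Rightarrow> complex" and \<mu> :: "'m mon"
  assumes A: "\<And>k j. 0 < j \<Longrightarrow> Apol b p k (of_nat j) \<noteq> 0"
    and B: "\<And>j. Bpol a p (of_nat j) \<noteq> 0"
    and n: "\<And>i. (\<lambda>t. of_nat (lk (n t) i) / of_nat t) \<longlonglongrightarrow> \<eta> i" and \<eta>: "\<And>k. \<eta> k \<noteq> 0"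
  shows "(\<lambda>t. hyp a b p \<kappa> 0 (n t + \<mu>) / hyp a b p \<kappa> 0 (n t))
     \<longlonglongrightarrow> (\<Prod>k\<in>UNIV. (((\<Sum>i\<in>UNIV. \<eta> i) / \<eta> k) ^ p) ^ lk \<mu> k)"
proof (induction "mdeg \<mu>" arbitrary: \<mu>)
  case 0
  then have "\<mu> = 0" by (intro poly_mapping_eqI) (auto simp: mdeg_UNIV)
  then show ?case using hyp_nonzero[OF A B] by simp
next
  case (Suc m)
  then have "\<exists>k. 0 < lk \<mu> k" by (auto simp: mdeg_UNIV gr0_conv_Suc[symmetric] intro: ccontr)
  then obtain k where k: "0 < lk \<mu> k" by blast
  define \<nu> where "\<nu> = \<mu> - Poly_Mapping.single k 1"
  have \<mu>: "\<mu> = \<nu> + Poly_Mapping.single k 1"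
    using k unfolding \<nu>_def mon_diff_single_iff[symmetric] by (simp add: add.commute)
  have "m = mdeg \<nu>" using Suc.hyps(2) by (simp add: \<mu> mdeg_add)
  note IH = Suc.hyps(1)[OF this]
  have "(\<lambda>t. of_nat (lk (n t + \<nu>) i) / of_nat t) \<longlonglongrightarrow> \<eta> i" for i
  proof -
    have "(\<lambda>t. of_nat (lk (n t) i) / of_nat t + of_nat (lk \<nu> i) / of_nat t) \<longlonglongrightarrow> \<eta> i + 0"
      by (intro tendsto_add n lim_const_over_n)
    then show ?thesis by (simp add: lookup_add add_divide_distrib)
  qed
  from tendsto_mult[OF hyp_ratio_single[OF A B this \<eta>, where k=k and \<kappa>=\<kappa>] IH]
  have "(\<lambda>t. hyp a b p \<kappa> 0 (n t + \<mu>) / hyp a b p \<kappa> 0 (n t))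
     \<longlonglongrightarrow> ((\<Sum>i\<in>UNIV. \<eta> i) / \<eta> k) ^ p * (\<Prod>k\<in>UNIV. (((\<Sum>i\<in>UNIV. \<eta> i) / \<eta> k) ^ p) ^ lk \<nu> k)"
    using hyp_nonzero[OF A B] by (simp add: \<mu> add.assoc)
  also have "((\<Sum>i\<in>UNIV. \<eta> i) / \<eta> k) ^ p * (\<Prod>k\<in>UNIV. (((\<Sum>i\<in>UNIV. \<eta> i) / \<eta> k) ^ p) ^ lk \<nu> k)
     = (\<Prod>k\<in>UNIV. (((\<Sum>i\<in>UNIV. \<eta> i) / \<eta> k) ^ p) ^ lk \<mu> k)"
  proof -
    have "(\<Prod>i\<in>UNIV. f i ^ lk \<mu> i) = f k * (\<Prod>i\<in>UNIV. f i ^ lk \<nu> i)" for f :: "'m \<Rightarrow> complex"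
    proof -
      have "(\<Prod>i\<in>UNIV. f i ^ lk \<mu> i) = (\<Prod>i\<in>UNIV. f i ^ lk \<nu> i) * (\<Prod>i\<in>UNIV. if i = k then f k else 1)"
        unfolding prod.distrib[symmetric]
        by (intro prod.cong) (auto simp: \<mu> lookup_add lookup_single when_def)
      then show ?thesis by (simp add: prod.delta)
    qed
    from this[of "\<lambda>k. ((\<Sum>i\<in>UNIV. \<eta> i) / \<eta> k) ^ p"] show ?thesis by simp
  qed
  finally show ?case .
qed

lemma mfalling_asymp:
  fixes \<gamma> :: "nat \<Rightarrow> 'm::finite mon" and \<eta> :: "'m \<Rightarrow> complex"
  assumes "\<And>i. (\<lambda>t. of_nat (lk (\<gamma> t) i) / of_nat t) \<longlonglongrightarrow> \<eta> i"
  shows "(\<lambda>t. mfalling \<beta> (\<gamma> t) / of_nat t ^ mdeg \<beta>) \<longlonglongrightarrow> (\<Prod>i\<in>UNIV. \<eta> i ^ lk \<beta> i)"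
proof -
  have "(\<lambda>t. \<Prod>i\<in>UNIV. \<Prod>j<lk \<beta> i. of_nat (lk (\<gamma> t) i) / of_nat t - of_nat j / of_nat t)
     \<longlonglongrightarrow> (\<Prod>i\<in>UNIV. \<Prod>j<lk \<beta> i. \<eta> i - 0)"
    by (intro tendsto_prod tendsto_diff assms lim_const_over_n)
  then show ?thesis
    by (simp add: mfalling_def mdeg_UNIV power_sum prod_dividef diff_divide_distrib[symmetric])
qed

text \<open>The coefficient of \<open>wact c F\<close> at \<open>n t = t e\<close> is zero. Divided
  by \<open>F (n t) t^(word c)\<close>, its terms of order \<open>word c\<close> converge to those
  of the principal symbol, and the terms of lower order tend to 0.\<close>

lemma psymbol_on_torus:
  fixes c :: "'m::finite wcoeff" and e :: "'m \<Rightarrow> nat"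
  assumes A: "\<And>k j. 0 < j \<Longrightarrow> Apol b p k (of_nat j) \<noteq> 0" and A0: "\<And>k. Apol b p k 0 = 0"
    and B: "\<And>j. Bpol a p (of_nat j) \<noteq> 0"
    and c: "wop c \<in> left_ideal_gen (ell a b p)"
    and e: "\<And>i. 0 < e i"
  defines "x \<equiv> \<lambda>i. (of_nat (e i) / of_nat (\<Sum>i\<in>UNIV. e i)) ^ p"
  shows "psymbol c x (\<lambda>i. of_nat (e i) / x i) = 0"
proof -
  \<comment> \<open>For \<open>N = 0\<close> every direction gives the same series, so
    \<open>undefined\<close> stands for an arbitrary one.\<close>
  define F where "F = hyp a b p undefined 0"
  define S :: complex where "S = of_nat (\<Sum>i\<in>UNIV. e i)"
  have "(\<Sum>i\<in>UNIV. e i) \<noteq> 0" using e by (auto dest: gr0_implies_Suc simp: sum_eq_0_iff)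
  then have S: "S \<noteq> 0" unfolding S_def of_nat_eq_0_iff .
  have x: "x i = (of_nat (e i) / S) ^ p" for i by (simp add: x_def S_def)
  have x0: "x i \<noteq> 0" for i using e[of i] S by (simp add: x)
  have F0: "F n \<noteq> 0" for n unfolding F_def by (intro hyp_nonzero A B) auto
  define n where "n = (\<lambda>t. mon_of (\<lambda>i. t * e i))"
  obtain C where C: "\<And>F n. wact c F n = (\<Sum>k\<in>UNIV. wact (C k) (ellact a b p k F) n)"
    using left_ideal_gen_wact[OF c] by blast
  have "ellact a b p k F = (\<lambda>_. 0)" for k
    unfolding F_def by (rule ext) (simp add: ellact_hyp[OF A A0] A0)
  then have wact0: "wact c F n = 0" for n
    unfolding C by (auto simp: wact_def intro!: sum.neutral)
  \<comment> \<open>The normalised summands of \<open>wact c F (n t)\<close>; \<open>lm\<close>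
    collects their limits.\<close>
  define trm where "trm = (\<lambda>(\<alpha>,\<beta>) t. (if \<alpha> + (n t - \<alpha>) = n t
      then lk c (\<alpha>,\<beta>) * mfalling \<beta> (n t - \<alpha> + \<beta>) * F (n t - \<alpha> + \<beta>) else 0) / (F (n t) * of_nat t ^ word c))"
  define lm where "lm = (\<lambda>(\<alpha>,\<beta>). lk c (\<alpha>,\<beta>) * (\<Prod>i\<in>UNIV. x i ^ lk \<alpha> i) *
      (if mdeg \<beta> = word c then \<Prod>i\<in>UNIV. (of_nat (e i) / x i) ^ lk \<beta> i else 0))"
  have "(\<lambda>t. trm k t) \<longlonglongrightarrow> lm k" if k: "k \<in> Poly_Mapping.keys c" for k
  proof (cases k)
    case (Pair \<alpha> \<beta>)
    have deg: "mdeg \<beta> \<le> word c"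
      unfolding word_def using k Pair by (intro Max_ge) force+
    have ev: "eventually (\<lambda>t. \<alpha> + (n t - \<alpha>) = n t) sequentially"
    proof (rule eventually_mono[OF eventually_ge_at_top[of "mdeg \<alpha>"]])
      fix t assume t: "mdeg \<alpha> \<le> t"
      have "lk \<alpha> i \<le> t * e i" for i
      proof -
        have "lk \<alpha> i \<le> mdeg \<alpha>" by (simp add: mdeg_UNIV member_le_sum)
        also have "\<dots> \<le> t" by (rule t)
        also have "\<dots> \<le> t * e i" using e[of i] by simp
        finally show ?thesis .
      qed
      then show "\<alpha> + (n t - \<alpha>) = n t"
        unfolding mon_add_diff by (simp add: n_def)
    qed
    \<comment> \<open>Base point for both ratios: eventually \<open>n t = m t + \<alpha>\<close>, so
      the quotient of \<open>F\<close> at \<open>m t + \<beta>\<close> by \<open>F (n t)\<close> is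
      a quotient of two ratios with nonnegative shifts, to which \<open>hyp_ratio\<close>
      applies.\<close>
    define m where "m = (\<lambda>t. n t - \<alpha>)"
    have m: "(\<lambda>t. of_nat (lk (m t) i) / of_nat t) \<longlonglongrightarrow> (of_nat (e i) :: complex)" for i
    proof -
      have "(\<lambda>t. of_nat (e i) - of_nat (lk \<alpha> i) / of_nat t) \<longlonglongrightarrow> (of_nat (e i) - 0 :: complex)"
        by (intro tendsto_diff tendsto_const lim_const_over_n)
      then have "(\<lambda>t. of_nat (e i) - of_nat (lk \<alpha> i) / of_nat t) \<longlonglongrightarrow> (of_nat (e i) :: complex)"
        by simp
      then show ?thesis
      proof (rule Lim_transform_eventually)
        show "eventually (\<lambda>t. of_nat (e i) - of_nat (lk \<alpha> i) / of_nat t = (of_nat (lk (m t) i) / of_nat t :: complex)) sequentially"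
          using ev eventually_gt_at_top[of 0]
        proof eventually_elim
          case (elim t)
          then have "lk \<alpha> i \<le> t * e i"
            unfolding mon_add_diff by (simp add: n_def)
          then have "(of_nat (lk (m t) i) :: complex) = of_nat t * of_nat (e i) - of_nat (lk \<alpha> i)"
            by (simp add: m_def n_def lookup_minus of_nat_diff)
          with elim show ?case by (simp add: field_simps)
        qed
      qed
    qed
    have m\<beta>: "(\<lambda>t. of_nat (lk (m t + \<beta>) i) / of_nat t) \<longlonglongrightarrow> (of_nat (e i) :: complex)" for i
    proof -
      have "(\<lambda>t. of_nat (lk (m t) i) / of_nat t + of_nat (lk \<beta> i) / of_nat t) \<longlonglongrightarrow> (of_nat (e i) + 0 :: complex)"
        by (intro tendsto_add m lim_const_over_n)
      then show ?thesis by (simp add: lookup_add add_divide_distrib)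
    qed
    have ratio: "(\<lambda>t. F (m t + \<mu>) / F (m t)) \<longlonglongrightarrow> (\<Prod>k\<in>UNIV. (1 / x k) ^ lk \<mu> k)" for \<mu>
      using hyp_ratio[OF A B m, where \<mu>=\<mu> and \<kappa>=undefined] e
      by (simp add: F_def x S_def power_one_over[symmetric] power_divide)
    have "(\<lambda>t. lk c (\<alpha>,\<beta>) * (mfalling \<beta> (m t + \<beta>) / of_nat t ^ mdeg \<beta>) *
        ((F (m t + \<beta>) / F (m t)) / (F (m t + \<alpha>) / F (m t))) * inverse (of_nat t ^ (word c - mdeg \<beta>)))
      \<longlonglongrightarrow> lk c (\<alpha>,\<beta>) * (\<Prod>i\<in>UNIV. of_nat (e i) ^ lk \<beta> i) *
        ((\<Prod>k\<in>UNIV. (1 / x k) ^ lk \<beta> k) / (\<Prod>k\<in>UNIV. (1 / x k) ^ lk \<alpha> k)) * (if mdeg \<beta> = word c then 1 else 0)"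
    proof (intro tendsto_mult tendsto_const mfalling_asymp m\<beta> tendsto_divide ratio)
      show "(\<Prod>k\<in>UNIV. (1 / x k) ^ lk \<alpha> k) \<noteq> 0" using x0 by simp
      show "(\<lambda>t. inverse (of_nat t ^ (word c - mdeg \<beta>))) \<longlonglongrightarrow> (if mdeg \<beta> = word c then 1 else 0 :: complex)"
      proof (cases "mdeg \<beta> = word c")
        case False
        with deg have "0 < word c - mdeg \<beta>" by simp
        then show ?thesis using False
          using tendsto_power[OF lim_inverse_n[where 'a=complex], of "word c - mdeg \<beta>"]
          by (simp add: power_inverse zero_power)
      qed simp
    qed
    also have "lk c (\<alpha>,\<beta>) * (\<Prod>i\<in>UNIV. of_nat (e i) ^ lk \<beta> i) *
        ((\<Prod>k\<in>UNIV. (1 / x k) ^ lk \<beta> k) / (\<Prod>k\<in>UNIV. (1 / x k) ^ lk \<alpha> k)) * (if mdeg \<beta> = word c then 1 else 0)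
       = lm k"
      by (simp add: lm_def Pair power_divide prod_dividef)
    finally show ?thesis
    proof (rule Lim_transform_eventually)
      show "eventually (\<lambda>t. lk c (\<alpha>,\<beta>) * (mfalling \<beta> (m t + \<beta>) / of_nat t ^ mdeg \<beta>) *
        ((F (m t + \<beta>) / F (m t)) / (F (m t + \<alpha>) / F (m t))) * inverse (of_nat t ^ (word c - mdeg \<beta>)) = trm k t) sequentially"
        using ev eventually_gt_at_top[of 0]
      proof eventually_elim
        case (elim t)
        have mt: "n t - \<alpha> = m t" by (simp add: m_def)
        have "m t + \<alpha> = n t" using elim by (simp add: m_def add.commute)
        moreover have "(of_nat t :: complex) ^ word c = of_nat t ^ mdeg \<beta> * of_nat t ^ (word c - mdeg \<beta>)"
          using deg by (simp add: power_add[symmetric])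
        ultimately show ?case
          using elim F0[of "m t"] by (simp add: trm_def Pair mt divide_simps)
      qed
    qed
  qed
  then have "(\<lambda>t. \<Sum>k\<in>Poly_Mapping.keys c. trm k t) \<longlonglongrightarrow> (\<Sum>k\<in>Poly_Mapping.keys c. lm k)"
    by (rule tendsto_sum)
  moreover have "(\<Sum>k\<in>Poly_Mapping.keys c. trm k t) = wact c F (n t) / (F (n t) * of_nat t ^ word c)" for t
    unfolding trm_def wact_def sum_divide_distrib by (intro sum.cong) auto
  ultimately have "(\<Sum>k\<in>Poly_Mapping.keys c. lm k) = 0"
    by (simp add: wact0 LIMSEQ_const_iff)
  moreover have "psymbol c x (\<lambda>i. of_nat (e i) / x i) = (\<Sum>k\<in>Poly_Mapping.keys c. lm k)"
    unfolding psymbol_def by (rule sum.mono_neutral_cong_left) (auto simp: lm_def split: if_splits)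
  ultimately show ?thesis by simp
qed

section \<open>Conormals of the coordinate hyperplanes\<close>

definition polyfun :: "(complex \<Rightarrow> complex) \<Rightarrow> bool" where
  "polyfun f \<longleftrightarrow> (\<exists>r. f = poly r)"

lemma polyfun_const: "polyfun (\<lambda>_. c)"
  unfolding polyfun_def by (rule exI[of _ "[:c:]"]) auto

lemma polyfun_ident: "polyfun (\<lambda>z. z)"
  unfolding polyfun_def by (rule exI[of _ "[:0, 1:]"]) auto

lemma polyfun_add: "polyfun f \<Longrightarrow> polyfun g \<Longrightarrow> polyfun (\<lambda>z. f z + g z)"
  unfolding polyfun_def by (auto intro: exI[of _ "_ + _"] simp: fun_eq_iff)

lemma polyfun_mult: "polyfun f \<Longrightarrow> polyfun g \<Longrightarrow> polyfun (\<lambda>z. f z * g z)"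
  unfolding polyfun_def by (auto intro: exI[of _ "_ * _"] simp: fun_eq_iff)

lemma polyfun_diff:
  assumes "polyfun f" "polyfun g" shows "polyfun (\<lambda>z. f z - g z)"
proof -
  have "polyfun (\<lambda>z. f z + (- 1) * g z)" by (intro polyfun_add polyfun_mult polyfun_const assms)
  then show ?thesis by simp
qed

lemma polyfun_divide_const: 
  assumes "polyfun f" shows "polyfun (\<lambda>z. f z / c)"
  using polyfun_mult[OF assms polyfun_const[of "inverse c"]] by (simp add: divide_inverse)

lemma polyfun_sum: "(\<And>i. i \<in> S \<Longrightarrow> polyfun (f i)) \<Longrightarrow> polyfun (\<lambda>z. \<Sum>i\<in>S. f i z)"
  by (induction S rule: infinite_finite_induct) (simp_all add: polyfun_const polyfun_add)

lemma polyfun_prod: "(\<And>i. i \<in> S \<Longrightarrow> polyfun (f i)) \<Longrightarrow> polyfun (\<lambda>z. \<Prod>i\<in>S. f i z)"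
  by (induction S rule: infinite_finite_induct) (simp_all add: polyfun_const polyfun_mult)

lemma polyfun_power: "polyfun f \<Longrightarrow> polyfun (\<lambda>z. f z ^ n)"
  by (induction n) (simp_all add: polyfun_const polyfun_mult)

text \<open>A nonzero polynomial has finitely many roots. This carries identities known for all
  large \<open>N\<close> to the value \<open>z = 0\<close>.\<close>

lemma polyfun_eq_zero:
  assumes "polyfun f" "\<And>N. N0 \<le> N \<Longrightarrow> f (of_nat N) = 0"
  shows "f z = 0"
proof -
  obtain r where r: "f = poly r" using assms(1) by (auto simp: polyfun_def)
  have "infinite ((of_nat :: nat \<Rightarrow> complex) ` {N0..})"
    using infinite_Ici by (simp add: finite_image_iff)
  moreover have "of_nat ` {N0..} \<subseteq> {z. poly r z = 0}"
    using assms(2) r by auto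
  ultimately have "r = 0" using poly_roots_finite finite_subset by metis
  then show ?thesis by (simp add: r)
qed

section \<open>Symbol coefficients along a coordinate hyperplane\<close>

lemma wact_altdef:
  "wact c F n = (\<Sum>k\<in>Poly_Mapping.keys c. if fst k + (n - fst k) = n
      then lk c k * mfalling (snd k) (n - fst k + snd k) * F (n - fst k + snd k) else 0)"
  unfolding wact_def by (intro sum.cong) auto

text \<open>Separates the falling factorial of length \<open>d\<close>, which is divided out before
  \<open>z\<close> is set to 0, from the remaining factors.\<close>

lemma falling_split:
  "(\<Prod>j<d + r. z - of_nat j) = (\<Prod>j<d. z - of_nat j) * (\<Prod>j<r. z - of_nat d - of_nat j :: complex)"
  by (induction r) (simp_all add: algebra_simps)

text \<open>Applying the operator to the series that starts at \<open>x_\<kappa>^N\<close> gives,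
  for large \<open>N\<close>, an identity between polynomials in \<open>N\<close> whose right side
  is divisible by \<open>Apol b p \<kappa>\<close>. At 0 the right side vanishes, and the left side
  is the coefficient in question when \<open>\<nu>\<close> is chosen minimal.\<close>

lemma symbol_coeff_boundary:
  fixes c :: "'m::finite wcoeff" and \<kappa> :: 'm and \<nu> :: "'m mon"
  assumes A: "\<And>k j. 0 < j \<Longrightarrow> Apol b p k (of_nat j) \<noteq> 0" and A0: "\<And>k. Apol b p k 0 = 0"
    and c: "wop c \<in> left_ideal_gen (ell a b p)"
    and \<nu>: "lk \<nu> \<kappa> = 0"
    and d: "\<And>k. k \<in> Poly_Mapping.keys c \<Longrightarrow> mdeg (snd k) \<le> d"
  shows "lk c (\<nu>, Poly_Mapping.single \<kappa> d) = 0"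
proof (rule ccontr)
  assume nz: "lk c (\<nu>, Poly_Mapping.single \<kappa> d) \<noteq> 0"
  \<comment> \<open>Compare coefficients of \<open>x^\<nu> x\<^sub>\<kappa>^(N - d)\<close>: on the left only terms \<open>x^\<alpha> \<partial>\<^sub>\<kappa>^d\<close> contribute.\<close>
  define bad where "bad = (\<lambda>\<alpha>. lk \<alpha> \<kappa> = 0 \<and> lk c (\<alpha>, Poly_Mapping.single \<kappa> d) \<noteq> 0)"
  have "bad \<nu>" using nz \<nu> by (simp add: bad_def)
  \<comment> \<open>Least degree ensures that no proper divisor of \<open>x^\<nu>\<close>
    contributes to \<open>L 0\<close> below.\<close>
  then obtain \<nu> where bad: "bad \<nu>" and min: "\<And>\<alpha>. bad \<alpha> \<Longrightarrow> mdeg \<nu> \<le> mdeg \<alpha>"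
    using ex_has_least_nat[of bad \<nu> mdeg] by blast
  have \<nu>: "lk \<nu> \<kappa> = 0" using bad by (simp add: bad_def)
  obtain C where C: "\<And>F n. wact c F n = (\<Sum>k\<in>UNIV. wact (C k) (ellact a b p k F) n)"
    using left_ideal_gen_wact[OF c] by blast
  \<comment> \<open>The coefficient of the series at \<open>\<mu> + N e_\<kappa>\<close> as a
    polynomial in \<open>z = N\<close>. For \<open>lk \<mu> \<kappa> = 0\<close> the denominator
    product in direction \<open>\<kappa>\<close> is empty, so the denominator is free of
    \<open>z\<close>.\<close>
  define h where "h = (\<lambda>z \<mu>. (\<Prod>j<mdeg \<mu>. Bpol a p (z + of_nat j)) /
     (\<Prod>k\<in>UNIV - {\<kappa>}. \<Prod>j\<in>{0<..lk \<mu> k}. Apol b p k (of_nat j)))"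
  have polyfun_h: "polyfun (\<lambda>z. h z \<mu>)" for \<mu>
    unfolding h_def Bpol_def
    by (intro polyfun_divide_const polyfun_prod polyfun_add polyfun_ident polyfun_const)
  have hyp_h: "hyp a b p \<kappa> N (\<mu> + Poly_Mapping.single \<kappa> N) = h (of_nat N) \<mu>" if "lk \<mu> \<kappa> = 0" for N \<mu>
  proof -
    have "(\<Prod>j=N..<mdeg (\<mu> + Poly_Mapping.single \<kappa> N). Bpol a p (of_nat j)) = (\<Prod>j<mdeg \<mu>. Bpol a p (of_nat N + of_nat j))"
      using prod.shift_bounds_nat_ivl[of "\<lambda>j. Bpol a p (of_nat j)" 0 N "mdeg \<mu>"]
      by (simp add: mdeg_add atLeast0LessThan add.commute)
    moreover have "(\<Prod>k\<in>UNIV. \<Prod>j\<in>{(if k = \<kappa> then N else 0)<..lk (\<mu> + Poly_Mapping.single \<kappa> N) k}. Apol b p k (of_nat j))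
      = (\<Prod>k\<in>UNIV - {\<kappa>}. \<Prod>j\<in>{0<..lk \<mu> k}. Apol b p k (of_nat j))"
      by (subst prod.remove[of _ \<kappa>]) (auto simp: lookup_add lookup_single that intro!: prod.cong)
    ultimately show ?thesis by (simp add: hyp_def h_def lookup_add that)
  qed
  \<comment> \<open>\<open>L\<close> and \<open>Apol * Q\<close> are the two sides of the
    coefficient comparison after removal of \<open>ff\<close>, with \<open>N\<close> replaced by
    \<open>z\<close>. The middle product in \<open>Q\<close> is the rest of a falling factorial of
    length \<open>d + lk (fst k) \<kappa>\<close>.\<close>
  define L where "L = (\<lambda>z. \<Sum>k\<in>Poly_Mapping.keys c.
     (if fst k + (\<nu> - fst k) = \<nu> \<and> snd k = Poly_Mapping.single \<kappa> d then lk c k else 0) * h z (\<nu> - fst k))"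
  define Q where "Q = (\<lambda>z. \<Sum>k\<in>Poly_Mapping.keys (C \<kappa>).
     (if (\<forall>i. i \<noteq> \<kappa> \<longrightarrow> lk (fst k) i \<le> lk \<nu> i) \<and> lk (snd k) \<kappa> = d + lk (fst k) \<kappa> then
       lk (C \<kappa>) k * (\<Prod>i\<in>UNIV - {\<kappa>}. \<Prod>j<lk (snd k) i. of_nat (lk (\<nu> - fst k + snd k) i) - of_nat j) else 0)
     * (\<Prod>j<lk (fst k) \<kappa>. z - of_nat d - of_nat j)
     * h z (\<nu> - fst k + snd k - Poly_Mapping.single \<kappa> (lk (snd k) \<kappa>)))"
  \<comment> \<open>From here on \<open>N - d\<close> exceeds or equals every
    \<open>x_\<kappa>\<close>-exponent in \<open>C \<kappa>\<close>, so which terms contribute no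
    longer depends on \<open>N\<close>.\<close>
  define N0 where "N0 = d + (\<Sum>k\<in>Poly_Mapping.keys (C \<kappa>). lk (fst k) \<kappa>)"
  have eq: "L (of_nat N) - Apol b p \<kappa> (of_nat N) * Q (of_nat N) = 0" if N: "N0 \<le> N" for N
  proof -
    define n where "n = \<nu> + Poly_Mapping.single \<kappa> (N - d)"
    define F where "F = hyp a b p \<kappa> N"
    define ff :: complex where "ff = (\<Prod>j<d. of_nat N - of_nat j)"
    have dN: "d \<le> N" using N by (simp add: N0_def)
    have ff: "ff \<noteq> 0" using dN by (auto simp: ff_def)
    have ellact_F: "ellact a b p k F m = (if k = \<kappa> \<and> lk m \<kappa> = N then Apol b p \<kappa> (of_nat N) * F m else 0)" for k m
      unfolding F_def by (rule ellact_hyp) (simp_all add: A A0)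
    have "wact c F n = ff * L (of_nat N)"
      unfolding wact_altdef L_def sum_distrib_left
    proof (rule sum.cong[OF refl])
      fix k assume k: "k \<in> Poly_Mapping.keys c"
      show "(if fst k + (n - fst k) = n then lk c k * mfalling (snd k) (n - fst k + snd k) * F (n - fst k + snd k) else 0)
        = ff * ((if fst k + (\<nu> - fst k) = \<nu> \<and> snd k = Poly_Mapping.single \<kappa> d then lk c k else 0) * h (of_nat N) (\<nu> - fst k))"
        (is "?l = ?r")
      proof (cases "fst k + (\<nu> - fst k) = \<nu> \<and> snd k = Poly_Mapping.single \<kappa> d")
        case True
        then have le: "\<forall>i. lk (fst k) i \<le> lk \<nu> i" by (simp add: mon_add_diff)
        then have z: "lk (fst k) \<kappa> = 0" using \<nu> by (metis le_zero_eq)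
        have 1: "fst k + (n - fst k) = n"
          using le by (auto simp: mon_add_diff n_def lookup_add intro: order_trans trans_le_add1)
        have 2: "n - fst k + snd k = (\<nu> - fst k) + Poly_Mapping.single \<kappa> N"
          using True dN z \<nu> by (intro poly_mapping_eqI) (auto simp: n_def lookup_add lookup_minus lookup_single when_def)
        have 3: "lk (\<nu> - fst k) \<kappa> = 0" by (simp add: lookup_minus \<nu>)
        have 4: "mfalling (snd k) (\<nu> - fst k + Poly_Mapping.single \<kappa> N) = ff"
          using True 3 by (simp add: mfalling_single ff_def lookup_add)
        have "?l = lk c k * ff * h (of_nat N) (\<nu> - fst k)"
          by (simp only: 1 2 4 F_def hyp_h[OF 3] if_True refl mult.assoc)
        then show ?thesis using True by simp
      next
        case False
        \<comment> \<open>The exponent of \<open>n\<close> in direction \<open>\<kappa>\<close> is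
          \<open>N - d\<close> and \<open>F\<close> vanishes below \<open>N\<close>. A contributing
          term must therefore spend all \<open>d\<close> derivatives on direction
          \<open>\<kappa>\<close> and contain no \<open>x_\<kappa>\<close>.\<close>
        have "?l = 0"
        proof (rule ccontr)
          assume "?l \<noteq> 0"
          then have 1: "fst k + (n - fst k) = n" and "F (n - fst k + snd k) \<noteq> 0"
            by (auto split: if_splits)
          then have "N \<le> lk (n - fst k + snd k) \<kappa>"
            by (auto simp: F_def hyp_def split: if_splits)
          moreover have "lk (fst k) \<kappa> \<le> N - d"
            using 1 \<nu> by (auto simp: mon_add_diff n_def lookup_add dest: spec[of _ \<kappa>])
          ultimately have ge: "d + lk (fst k) \<kappa> \<le> lk (snd k) \<kappa>"
            using \<nu> dN by (simp add: n_def lookup_add lookup_minus)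
          have "mdeg (snd k) = lk (snd k) \<kappa> + (\<Sum>i\<in>UNIV - {\<kappa>}. lk (snd k) i)"
            unfolding mdeg_UNIV by (subst sum.remove[of _ \<kappa>]) auto
          with ge d[OF k] have "lk (fst k) \<kappa> = 0" "lk (snd k) \<kappa> = d" "(\<Sum>i\<in>UNIV - {\<kappa>}. lk (snd k) i) = 0"
            by linarith+
          then have sk: "snd k = Poly_Mapping.single \<kappa> d" and z: "lk (fst k) \<kappa> = 0"
            by (auto intro!: poly_mapping_eqI simp: lookup_single when_def)
          have "lk (fst k) i \<le> lk \<nu> i" for i
          proof (cases "i = \<kappa>")
            case False
            then have "lk n i = lk \<nu> i" by (simp add: n_def lookup_add lookup_single)
            then show ?thesis using 1 by (metis mon_add_diff)
          qed (simp add: z)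
          then have "fst k + (\<nu> - fst k) = \<nu>" by (simp add: mon_add_diff)
          with sk show False using False by simp
        qed
        with False show ?thesis by auto
      qed
    qed
    moreover have "wact c F n = wact (C \<kappa>) (ellact a b p \<kappa> F) n"
    proof -
      \<comment> \<open>Among the generators only the one for \<open>\<kappa>\<close> fails to
        annihilate the series.\<close>
      have "wact (C k) (ellact a b p k F) n = 0" if "k \<noteq> \<kappa>" for k
        using that unfolding wact_altdef by (intro sum.neutral) (simp add: ellact_F)
      then show ?thesis unfolding C by (subst sum.remove[of _ \<kappa>]) auto
    qed
    moreover have "wact (C \<kappa>) (ellact a b p \<kappa> F) n = ff * (Apol b p \<kappa> (of_nat N) * Q (of_nat N))"
      unfolding wact_altdef Q_def sum_distrib_left
    proof (rule sum.cong[OF refl])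
      fix k assume k: "k \<in> Poly_Mapping.keys (C \<kappa>)"
      have "lk (fst k) \<kappa> \<le> (\<Sum>k\<in>Poly_Mapping.keys (C \<kappa>). lk (fst k) \<kappa>)"
        using k by (intro member_le_sum) auto
      with N have small: "lk (fst k) \<kappa> \<le> N - d" by (simp add: N0_def)
      have cond: "fst k + (n - fst k) = n \<longleftrightarrow> (\<forall>i. i \<noteq> \<kappa> \<longrightarrow> lk (fst k) i \<le> lk \<nu> i)"
        unfolding mon_add_diff using small \<nu> by (auto simp: n_def lookup_add lookup_single when_def)
      have comp: "lk (n - fst k + snd k) \<kappa> = N \<longleftrightarrow> lk (snd k) \<kappa> = d + lk (fst k) \<kappa>"
        using small dN \<nu> by (auto simp: n_def lookup_add lookup_minus)
      define \<mu> where "\<mu> = \<nu> - fst k + snd k - Poly_Mapping.single \<kappa> (lk (snd k) \<kappa>)"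
      have main: "mfalling (snd k) (n - fst k + snd k) * F (n - fst k + snd k)
         = ff * (\<Prod>j<lk (fst k) \<kappa>. of_nat N - of_nat d - of_nat j) *
           (\<Prod>i\<in>UNIV - {\<kappa>}. \<Prod>j<lk (snd k) i. of_nat (lk (\<nu> - fst k + snd k) i) - of_nat j) * h (of_nat N) \<mu>"
        if s: "lk (snd k) \<kappa> = d + lk (fst k) \<kappa>"
      proof -
        have 1: "n - fst k + snd k = \<mu> + Poly_Mapping.single \<kappa> N"
          using s small dN \<nu>
          by (intro poly_mapping_eqI) (auto simp: \<mu>_def n_def lookup_add lookup_minus lookup_single when_def)
        have 2: "lk \<mu> \<kappa> = 0" by (simp add: \<mu>_def lookup_minus lookup_add \<nu>)
        have 3: "mfalling (snd k) (n - fst k + snd k) = ff * (\<Prod>j<lk (fst k) \<kappa>. of_nat N - of_nat d - of_nat j) *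
           (\<Prod>i\<in>UNIV - {\<kappa>}. \<Prod>j<lk (snd k) i. of_nat (lk (\<nu> - fst k + snd k) i) - of_nat j)"
        proof -
          have "mfalling (snd k) (n - fst k + snd k) =
             (\<Prod>j<lk (snd k) \<kappa>. of_nat (lk (n - fst k + snd k) \<kappa>) - of_nat j) *
             (\<Prod>i\<in>UNIV - {\<kappa>}. \<Prod>j<lk (snd k) i. of_nat (lk (n - fst k + snd k) i) - of_nat j)"
            unfolding mfalling_def by (subst prod.remove[of _ \<kappa>]) auto
          also have "(\<Prod>i\<in>UNIV - {\<kappa>}. \<Prod>j<lk (snd k) i. of_nat (lk (n - fst k + snd k) i) - of_nat j)
            = (\<Prod>i\<in>UNIV - {\<kappa>}. \<Prod>j<lk (snd k) i. of_nat (lk (\<nu> - fst k + snd k) i) - of_nat j :: complex)"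
            by (intro prod.cong) (auto simp: n_def lookup_add lookup_minus lookup_single)
          also have "lk (n - fst k + snd k) \<kappa> = N" using comp s by simp
          finally show ?thesis by (simp only: s falling_split ff_def)
        qed
        show ?thesis unfolding 3 by (simp add: 1 F_def hyp_h[OF 2])
      qed
      show "(if fst k + (n - fst k) = n then lk (C \<kappa>) k * mfalling (snd k) (n - fst k + snd k) * ellact a b p \<kappa> F (n - fst k + snd k) else 0)
        = ff * (Apol b p \<kappa> (of_nat N) * (
     (if (\<forall>i. i \<noteq> \<kappa> \<longrightarrow> lk (fst k) i \<le> lk \<nu> i) \<and> lk (snd k) \<kappa> = d + lk (fst k) \<kappa> then
       lk (C \<kappa>) k * (\<Prod>i\<in>UNIV - {\<kappa>}. \<Prod>j<lk (snd k) i. of_nat (lk (\<nu> - fst k + snd k) i) - of_nat j) else 0)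
     * (\<Prod>j<lk (fst k) \<kappa>. of_nat N - of_nat d - of_nat j)
     * h (of_nat N) (\<nu> - fst k + snd k - Poly_Mapping.single \<kappa> (lk (snd k) \<kappa>))))"
        unfolding ellact_F cond comp \<mu>_def[symmetric] using main by auto
    qed
    ultimately show ?thesis using ff by simp
  qed
  have "polyfun (\<lambda>z. L z - Apol b p \<kappa> z * Q z)"
    unfolding L_def Q_def Apol_def
    by (intro polyfun_diff polyfun_mult polyfun_sum polyfun_prod polyfun_h polyfun_const polyfun_add polyfun_ident)
  \<comment> \<open>No series with \<open>N = 0\<close> is involved: the polynomial identity valid
    for all \<open>N \<ge> N0\<close> is evaluated at the root 0 of
    \<open>Apol b p \<kappa>\<close>.\<close>
  then have "L 0 - Apol b p \<kappa> 0 * Q 0 = 0"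
    by (rule polyfun_eq_zero) (rule eq)
  then have "L 0 = 0" by (simp add: A0)
  moreover have "L 0 = lk c (\<nu>, Poly_Mapping.single \<kappa> d)"
  proof -
    have "L 0 = (\<Sum>k\<in>Poly_Mapping.keys c. if k = (\<nu>, Poly_Mapping.single \<kappa> d) then lk c k else 0)"
      unfolding L_def
    proof (rule sum.cong[OF refl])
      fix k assume k: "k \<in> Poly_Mapping.keys c"
      show "(if fst k + (\<nu> - fst k) = \<nu> \<and> snd k = Poly_Mapping.single \<kappa> d then lk c k else 0) * h 0 (\<nu> - fst k)
        = (if k = (\<nu>, Poly_Mapping.single \<kappa> d) then lk c k else 0)"
      proof (cases "fst k + (\<nu> - fst k) = \<nu> \<and> snd k = Poly_Mapping.single \<kappa> d")
        case True
        then have "lk (fst k) \<kappa> = 0" using \<nu> by (metis mon_add_diff le_zero_eq)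
        with True k have "bad (fst k)" unfolding bad_def in_keys_iff by (metis prod.collapse)
        with min have "mdeg \<nu> \<le> mdeg (fst k)" by blast
        moreover have "mdeg \<nu> = mdeg (fst k) + mdeg (\<nu> - fst k)"
          using True by (metis mdeg_add)
        ultimately have "mdeg (\<nu> - fst k) = 0" by simp
        then have z: "\<nu> - fst k = 0" by (intro poly_mapping_eqI) (simp add: mdeg_UNIV)
        with True have "fst k = \<nu>" by simp
        with True have "k = (\<nu>, Poly_Mapping.single \<kappa> d)" by (metis prod.collapse)
        moreover have "h 0 0 = 1" by (simp add: h_def mdeg_def)
        ultimately show ?thesis by simp
      next
        case False
        then have "k \<noteq> (\<nu>, Poly_Mapping.single \<kappa> d)" by auto
        then show ?thesis by (simp only: False if_False mult_zero_left)
      qed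
    qed
    then show ?thesis by (simp add: sum.delta in_keys_iff)
  qed
  ultimately show False using bad by (simp add: bad_def)
qed

text \<open>At this point only monomials without \<open>x_\<kappa>\<close> and with a pure power of
  \<open>\<xi>_\<kappa>\<close> survive; their coefficients vanish by
  \<open>symbol_coeff_boundary\<close> with \<open>d = word c\<close>.\<close>

lemma psymbol_boundary:
  fixes c :: "'m::finite wcoeff" and \<kappa> :: 'm
  assumes A: "\<And>k j. 0 < j \<Longrightarrow> Apol b p k (of_nat j) \<noteq> 0" and A0: "\<And>k. Apol b p k 0 = 0"
    and c: "wop c \<in> left_ideal_gen (ell a b p)"
    and x: "x \<kappa> = 0"
  shows "psymbol c x (\<lambda>i. if i = \<kappa> then 1 else 0) = 0"
proof -
  have deg: "mdeg (snd k) \<le> word c" if "k \<in> Poly_Mapping.keys c" for k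
    unfolding word_def using that by (intro Max_ge) (auto simp: image_iff case_prod_beta)
  have "lk c (\<alpha>,\<beta>) * (\<Prod>i\<in>UNIV. x i ^ lk \<alpha> i) * (\<Prod>i\<in>UNIV. (if i = \<kappa> then 1 else 0) ^ lk \<beta> i) = 0"
    if k: "mdeg \<beta> = word c" for \<alpha> \<beta>
  proof (rule ccontr)
    assume *: "\<not> ?thesis"
    from * have "lk \<alpha> \<kappa> = 0" using x by (auto simp: zero_power)
    moreover have "lk \<beta> i = 0" if "i \<noteq> \<kappa>" for i
      using * that by (auto simp: zero_power)
    then have \<beta>: "\<beta> = Poly_Mapping.single \<kappa> (lk \<beta> \<kappa>)"
      by (intro poly_mapping_eqI) (auto simp: lookup_single when_def)
    then have "mdeg \<beta> = lk \<beta> \<kappa>" by (metis mdeg_single)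
    with k \<beta> have "\<beta> = Poly_Mapping.single \<kappa> (word c)" by simp
    ultimately have "lk c (\<alpha>,\<beta>) = 0"
      using symbol_coeff_boundary[OF A A0 c _ deg] by blast
    with * show False by simp
  qed
  then show ?thesis unfolding psymbol_def by (intro sum.neutral) auto
qed

section \<open>Principal symbols of the generators\<close>

text \<open>The degree \<open>d\<close> is prescribed, unlike the exact order in
  \<open>psymbol\<close>; this makes the symbol additive, with cancellation allowed.\<close>

definition wsymbol :: "nat \<Rightarrow> 'm::finite wcoeff \<Rightarrow> ('m \<Rightarrow> complex) \<Rightarrow> ('m \<Rightarrow> complex) \<Rightarrow> complex" where
  "wsymbol d c x \<xi> = (\<Sum>k\<in>Poly_Mapping.keys c. lk c k *
     (if mdeg (snd k) = d then (\<Prod>i\<in>UNIV. x i ^ lk (fst k) i) * (\<Prod>i\<in>UNIV. \<xi> i ^ lk (snd k) i) else 0))"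

text \<open>Operators are given as functions, so a normally ordered form is quantified
  existentially. The order is only bounded by \<open>d\<close>, and \<open>\<sigma>\<close> may be
  zero.\<close>

definition has_symbol :: "'m::finite wop \<Rightarrow> nat \<Rightarrow> (('m \<Rightarrow> complex) \<Rightarrow> ('m \<Rightarrow> complex) \<Rightarrow> complex) \<Rightarrow> bool" where
  "has_symbol T d \<sigma> \<longleftrightarrow> (\<exists>c. T = wop c \<and> (\<forall>k\<in>Poly_Mapping.keys c. mdeg (snd k) \<le> d) \<and> wsymbol d c = \<sigma>)"

lemma wop_altdef:
  "wop c f = (\<Sum>k\<in>Poly_Mapping.keys c. Poly_Mapping.single (fst k) (lk c k) * dpow (snd k) f)"
  unfolding wop_def by (intro sum.cong) auto

lemma wop_add: "wop (c + c') f = wop c f + wop c' f"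
  unfolding wop_altdef
  by (rule setsum_keys_plus_distrib) (simp_all add: single_add distrib_right)

lemma wop_single: "wop (Poly_Mapping.single k v) f = Poly_Mapping.single (fst k) v * dpow (snd k) f"
  unfolding wop_altdef by (rule sum_keys_single) simp

lemma wsymbol_add: "wsymbol d (c + c') x \<xi> = wsymbol d c x \<xi> + wsymbol d c' x \<xi>"
  unfolding wsymbol_def by (rule setsum_keys_plus_distrib) (simp_all add: distrib_right)

lemma has_symbol_zero: "has_symbol (\<lambda>_. 0) d (\<lambda>_ _. 0)"
  unfolding has_symbol_def by (rule exI[of _ 0]) (simp add: wop_def wsymbol_def fun_eq_iff)

lemma has_symbol_add:
  assumes "has_symbol T d \<sigma>" "has_symbol T' d \<sigma>'"
  shows "has_symbol (\<lambda>f. T f + T' f) d (\<lambda>x \<xi>. \<sigma> x \<xi> + \<sigma>' x \<xi>)"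
proof -
  obtain c c' where c: "T = wop c" "\<forall>k\<in>Poly_Mapping.keys c. mdeg (snd k) \<le> d" "wsymbol d c = \<sigma>"
    and c': "T' = wop c'" "\<forall>k\<in>Poly_Mapping.keys c'. mdeg (snd k) \<le> d" "wsymbol d c' = \<sigma>'"
    using assms by (auto simp: has_symbol_def)
  have "\<forall>k\<in>Poly_Mapping.keys (c + c'). mdeg (snd k) \<le> d"
    using c(2) c'(2) Poly_Mapping.keys_add[of c c'] by blast
  moreover have "(\<lambda>f. T f + T' f) = wop (c + c')"
    using c(1) c'(1) by (simp add: wop_add fun_eq_iff)
  moreover have "wsymbol d (c + c') = (\<lambda>x \<xi>. \<sigma> x \<xi> + \<sigma>' x \<xi>)"
    using c(3) c'(3) by (simp add: wsymbol_add fun_eq_iff)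
  ultimately show ?thesis unfolding has_symbol_def by blast
qed

lemma has_symbol_sum:
  assumes "\<And>i. i \<in> S \<Longrightarrow> has_symbol (T i) d (\<sigma> i)"
  shows "has_symbol (\<lambda>f. \<Sum>i\<in>S. T i f) d (\<lambda>x \<xi>. \<Sum>i\<in>S. \<sigma> i x \<xi>)"
  using assms by (induction S rule: infinite_finite_induct) (simp_all add: has_symbol_zero has_symbol_add)

lemma has_symbol_monomial:
  assumes "mdeg \<beta> \<le> d"
  shows "has_symbol (\<lambda>f. Poly_Mapping.single \<alpha> v * dpow \<beta> f) d
    (\<lambda>x \<xi>. v * (if mdeg \<beta> = d then (\<Prod>i\<in>UNIV. x i ^ lk \<alpha> i) * (\<Prod>i\<in>UNIV. \<xi> i ^ lk \<beta> i) else 0))"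
  unfolding has_symbol_def
proof (intro exI conjI)
  show "(\<lambda>f. Poly_Mapping.single \<alpha> v * dpow \<beta> f) = wop (Poly_Mapping.single (\<alpha>, \<beta>) v)"
    by (simp add: wop_single fun_eq_iff)
  show "\<forall>k\<in>Poly_Mapping.keys (Poly_Mapping.single (\<alpha>, \<beta>) v). mdeg (snd k) \<le> d"
    using assms by simp
  show "wsymbol d (Poly_Mapping.single (\<alpha>, \<beta>) v) = (\<lambda>x \<xi>. v * (if mdeg \<beta> = d then (\<Prod>i\<in>UNIV. x i ^ lk \<alpha> i) * (\<Prod>i\<in>UNIV. \<xi> i ^ lk \<beta> i) else 0))"
    unfolding wsymbol_def fun_eq_iff
    by (intro allI, subst sum_keys_single) auto
qed

lemma has_symbol_id: "has_symbol (\<lambda>f :: 'm::finite cpoly. f) 0 (\<lambda>_ _. 1)"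
proof -
  have "dpow 0 = (\<lambda>f :: 'm::finite cpoly. f)"
    by (intro ext poly_mapping_eqI) (simp add: lookup_dpow mfalling_def)
  then show ?thesis
    using has_symbol_monomial[of "0 :: 'm mon" 0 0 1] by (simp add: mdeg_def)
qed

text \<open>Reduces composition from the left with an additive \<open>E\<close> to monomial
  operators; it serves for \<open>x_k\<close>, constants and Euler operators alike.\<close>

lemma has_symbol_compose:
  fixes T E :: "'m::finite wop"
  assumes T: "has_symbol T d \<sigma>"
    and add: "\<And>(S :: ('m mon \<times> 'm mon) set) g. finite S \<Longrightarrow> E (\<Sum>k\<in>S. g k) = (\<Sum>k\<in>S. E (g k :: 'm cpoly) :: 'm cpoly)"
    and mono: "\<And>\<alpha> \<beta> v. mdeg \<beta> \<le> d \<Longrightarrow> has_symbol (\<lambda>f. E (Poly_Mapping.single \<alpha> v * dpow \<beta> f)) d'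
       (\<lambda>x \<xi>. \<tau> x \<xi> * (v * (if mdeg \<beta> = d then (\<Prod>i\<in>UNIV. x i ^ lk \<alpha> i) * (\<Prod>i\<in>UNIV. \<xi> i ^ lk \<beta> i) else 0)))"
  shows "has_symbol (\<lambda>f. E (T f)) d' (\<lambda>x \<xi>. \<tau> x \<xi> * \<sigma> x \<xi>)"
proof -
  obtain c where c: "T = wop c" "\<forall>k\<in>Poly_Mapping.keys c. mdeg (snd k) \<le> d" "wsymbol d c = \<sigma>"
    using T by (auto simp: has_symbol_def)
  have "has_symbol (\<lambda>f. \<Sum>k\<in>Poly_Mapping.keys c. E (Poly_Mapping.single (fst k) (lk c k) * dpow (snd k) f)) d'
     (\<lambda>x \<xi>. \<Sum>k\<in>Poly_Mapping.keys c. \<tau> x \<xi> * (lk c k * (if mdeg (snd k) = d then (\<Prod>i\<in>UNIV. x i ^ lk (fst k) i) * (\<Prod>i\<in>UNIV. \<xi> i ^ lk (snd k) i) else 0)))"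
    by (intro has_symbol_sum mono) (use c(2) in blast)
  then show ?thesis
    by (simp add: c(1) c(3)[symmetric] wop_altdef add wsymbol_def sum_distrib_left)
qed

lemma mono_add_single:
  fixes x :: "'m::finite \<Rightarrow> complex"
  shows "(\<Prod>i\<in>UNIV. x i ^ lk (\<alpha> + Poly_Mapping.single k 1) i) = (\<Prod>i\<in>UNIV. x i ^ lk \<alpha> i) * x k"
proof -
  have "(\<Prod>i\<in>UNIV. x i ^ lk (\<alpha> + Poly_Mapping.single k 1) i) = (\<Prod>i\<in>UNIV. x i ^ lk \<alpha> i) * (\<Prod>i\<in>UNIV. if i = k then x k else 1)"
    unfolding prod.distrib[symmetric] by (intro prod.cong) (auto simp: lookup_add lookup_single)
  then show ?thesis by (simp add: prod.delta)
qed

lemma has_symbol_xmon: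
  fixes T :: "'m::finite wop"
  assumes "has_symbol T d \<sigma>"
  shows "has_symbol (\<lambda>f. xmon (Poly_Mapping.single k 1) * T f) d (\<lambda>x \<xi>. x k * \<sigma> x \<xi>)"
  using assms
proof (rule has_symbol_compose)
  fix \<alpha> \<beta> :: "'m mon" and v :: complex assume d: "mdeg \<beta> \<le> d"
  have "xmon (Poly_Mapping.single k 1) * (Poly_Mapping.single \<alpha> v * dpow \<beta> f)
      = Poly_Mapping.single (\<alpha> + Poly_Mapping.single k 1) v * dpow \<beta> f" for f
    by (simp only: xmon_def mult.assoc[symmetric] mult_single mult_1_left add.commute)
  moreover have "(\<lambda>x \<xi>. x k * (v * (if mdeg \<beta> = d then (\<Prod>i\<in>UNIV. x i ^ lk \<alpha> i) * (\<Prod>i\<in>UNIV. \<xi> i ^ lk \<beta> i) else 0)))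
    = (\<lambda>x \<xi>. v * (if mdeg \<beta> = d then (\<Prod>i\<in>UNIV. x i ^ lk (\<alpha> + Poly_Mapping.single k 1) i) * (\<Prod>i\<in>UNIV. \<xi> i ^ lk \<beta> i) else 0))"
    unfolding mono_add_single by (simp add: fun_eq_iff)
  ultimately show "has_symbol (\<lambda>f. xmon (Poly_Mapping.single k 1) * (Poly_Mapping.single \<alpha> v * dpow \<beta> f)) d
     (\<lambda>x \<xi>. x k * (v * (if mdeg \<beta> = d then (\<Prod>i\<in>UNIV. x i ^ lk \<alpha> i) * (\<Prod>i\<in>UNIV. \<xi> i ^ lk \<beta> i) else 0)))"
    by (simp only: has_symbol_monomial[OF d])
qed (simp add: sum_distrib_left)

lemma mfalling_add_single:
  "mfalling (\<beta> + Poly_Mapping.single k 1) \<gamma> = mfalling \<beta> \<gamma> * (of_nat (lk \<gamma> k) - of_nat (lk \<beta> k))"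
proof -
  have "mfalling (\<beta> + Poly_Mapping.single k 1) \<gamma> = mfalling \<beta> \<gamma> *
     (\<Prod>i\<in>UNIV. if i = k then of_nat (lk \<gamma> k) - of_nat (lk \<beta> k) else 1)"
    unfolding mfalling_def prod.distrib[symmetric]
    by (intro prod.cong) (auto simp: lookup_add lookup_single)
  then show ?thesis by (simp add: prod.delta)
qed

text \<open>Normal ordering by the Leibniz rule: one term keeps the order of
  \<open>\<partial>^\<beta>\<close>, the other raises it by one and carries the symbol.\<close>

lemma euler_monomial:
  fixes \<alpha> \<beta> :: "'m::finite mon"
  shows "euler k (Poly_Mapping.single \<alpha> v * dpow \<beta> f) =
    Poly_Mapping.single \<alpha> (of_nat (lk \<alpha> k) * v) * dpow \<beta> f +
    Poly_Mapping.single (\<alpha> + Poly_Mapping.single k 1) v * dpow (\<beta> + Poly_Mapping.single k 1) f"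
proof (rule poly_mapping_eqI)
  fix n
  define m where "m = n - \<alpha>"
  show "lk (euler k (Poly_Mapping.single \<alpha> v * dpow \<beta> f)) n = lk (Poly_Mapping.single \<alpha> (of_nat (lk \<alpha> k) * v) * dpow \<beta> f +
    Poly_Mapping.single (\<alpha> + Poly_Mapping.single k 1) v * dpow (\<beta> + Poly_Mapping.single k 1) f) n"
  proof (cases "\<alpha> + m = n")
    case True
    then have n: "n = \<alpha> + m" by simp
    have s: "lk (Poly_Mapping.single (\<alpha> + Poly_Mapping.single k 1) v * dpow (\<beta> + Poly_Mapping.single k 1) f) n
      = v * (of_nat (lk m k) * mfalling \<beta> (m + \<beta>) * lk f (m + \<beta>))"
    proof (cases "lk m k = 0")
      case True
      then have "\<alpha> + Poly_Mapping.single k 1 + (n - (\<alpha> + Poly_Mapping.single k 1)) \<noteq> n"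
        unfolding mon_add_diff by (auto simp: n lookup_add lookup_single not_le intro!: exI[of _ k])
      then show ?thesis using True by (simp add: lookup_single_times)
    next
      case False
      define m' where "m' = m - Poly_Mapping.single k 1"
      have m: "m = Poly_Mapping.single k 1 + m'" using False mon_diff_single_iff[of k m] by (simp add: m'_def)
      have d: "n - (\<alpha> + Poly_Mapping.single k 1) = m'" unfolding n m by (simp add: add.assoc[symmetric])
      have "m' + (\<beta> + Poly_Mapping.single k 1) = m + \<beta>" by (simp add: m ac_simps)
      then show ?thesis
        unfolding lookup_single_times d lookup_dpow
        by (simp only: mfalling_add_single) (simp add: n m lookup_add ac_simps)
    qed
    show ?thesis
      unfolding lookup_add s unfolding lookup_euler lookup_single_times m_def[symmetric] lookup_dpow
      by (simp add: n lookup_add algebra_simps)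
  next
    case False
    have "\<alpha> + Poly_Mapping.single k 1 + (n - (\<alpha> + Poly_Mapping.single k 1)) \<noteq> n"
    proof
      assume "\<alpha> + Poly_Mapping.single k 1 + (n - (\<alpha> + Poly_Mapping.single k 1)) = n"
      then have "\<forall>i. lk \<alpha> i \<le> lk n i" by (auto simp: mon_add_diff lookup_add dest: add_leD1)
      then show False using False by (simp add: m_def mon_add_diff)
    qed
    then show ?thesis using False by (simp add: lookup_add lookup_euler lookup_single_times m_def)
  qed
qed

lemma has_symbol_raise:
  assumes "has_symbol T d \<sigma>"
  shows "has_symbol T (Suc d) (\<lambda>_ _. 0)"
proof -
  obtain c where c: "T = wop c" "\<forall>k\<in>Poly_Mapping.keys c. mdeg (snd k) \<le> d"
    using assms by (auto simp: has_symbol_def)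
  have "wsymbol (Suc d) c = (\<lambda>_ _. 0)"
    unfolding wsymbol_def fun_eq_iff using c(2) by (auto intro!: sum.neutral)
  with c show ?thesis unfolding has_symbol_def by (metis le_SucI)
qed

lemma has_symbol_euler:
  fixes T :: "'m::finite wop"
  assumes "has_symbol T d \<sigma>"
  shows "has_symbol (\<lambda>f. euler k (T f)) (Suc d) (\<lambda>x \<xi>. (x k * \<xi> k) * \<sigma> x \<xi>)"
  using assms
proof (rule has_symbol_compose)
  show "euler k (sum g S) = (\<Sum>k'\<in>S. euler k (g k'))" 
    for S :: "('m mon \<times> 'm mon) set" and g :: "'m mon \<times> 'm mon \<Rightarrow> 'm cpoly"
    by (rule poly_mapping_eqI) (simp add: lookup_euler lookup_sum sum_distrib_left)
next
  fix \<alpha> \<beta> :: "'m mon" and v :: complex assume d: "mdeg \<beta> \<le> d"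
  let ?e = "Poly_Mapping.single k 1 :: 'm mon"
  have "mdeg (\<beta> + ?e) \<le> Suc d" using d by (simp add: mdeg_add)
  from has_symbol_add[OF has_symbol_raise[OF has_symbol_monomial[OF d]] has_symbol_monomial[OF this], of \<alpha> "of_nat (lk \<alpha> k) * v" "\<alpha> + ?e" v]
  show "has_symbol (\<lambda>f. euler k (Poly_Mapping.single \<alpha> v * dpow \<beta> f)) (Suc d)
     (\<lambda>x \<xi>. x k * \<xi> k * (v * (if mdeg \<beta> = d then (\<Prod>i\<in>UNIV. x i ^ lk \<alpha> i) * (\<Prod>i\<in>UNIV. \<xi> i ^ lk \<beta> i) else 0)))"
    unfolding euler_monomial mono_add_single
    by (rule back_subst[where P = "has_symbol _ _"]) (simp add: mdeg_add fun_eq_iff)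
qed

lemma has_symbol_const_mult:
  fixes T :: "'m::finite wop"
  assumes "has_symbol T d \<sigma>"
  shows "has_symbol (\<lambda>f. const_poly r * T f) d (\<lambda>x \<xi>. r * \<sigma> x \<xi>)"
  using assms
proof (rule has_symbol_compose)
  fix \<alpha> \<beta> :: "'m mon" and v :: complex assume d: "mdeg \<beta> \<le> d"
  from has_symbol_monomial[OF d, of \<alpha> "r * v"]
  show "has_symbol (\<lambda>f. const_poly r * (Poly_Mapping.single \<alpha> v * dpow \<beta> f)) d
     (\<lambda>x \<xi>. r * (v * (if mdeg \<beta> = d then (\<Prod>i\<in>UNIV. x i ^ lk \<alpha> i) * (\<Prod>i\<in>UNIV. \<xi> i ^ lk \<beta> i) else 0)))"
    by (simp add: const_poly_def mult_single mult.assoc[symmetric])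
qed (simp add: sum_distrib_left)

text \<open>Stated for an arbitrary \<open>T\<close> on the right so that the induction can absorb
  the innermost factor into \<open>T\<close>. The constants \<open>r i\<close> have lower order and
  drop out.\<close>

lemma has_symbol_comp_prod:
  fixes T :: "'m::finite wop"
  assumes E: "\<And>T d \<sigma>. has_symbol T d \<sigma> \<Longrightarrow> has_symbol (\<lambda>f. E (T f)) (Suc d) (\<lambda>x \<xi>. \<tau> x \<xi> * \<sigma> x \<xi>)"
    and T: "has_symbol T d \<sigma>"
  shows "has_symbol (\<lambda>f. comp_prod (\<lambda>i g. E g + const_poly (r i) * g) p (T f)) (d + p) (\<lambda>x \<xi>. \<tau> x \<xi> ^ p * \<sigma> x \<xi>)"
  using T
proof (induction p arbitrary: T d \<sigma>)
  case 0
  then show ?case by (simp add: comp_prod_0)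
next
  case (Suc p)
  have "has_symbol (\<lambda>f. E (T f) + const_poly (r (Suc p)) * T f) (Suc d) (\<lambda>x \<xi>. \<tau> x \<xi> * \<sigma> x \<xi> + 0)"
    by (intro has_symbol_add E Suc.prems has_symbol_raise[OF has_symbol_const_mult[OF Suc.prems]])
  from Suc.IH[OF this] show ?case
    by (simp add: comp_prod_Suc ac_simps)
qed

lemma has_symbol_ell:
  fixes k :: "'m::finite"
  shows "has_symbol (ell a b p k) p (\<lambda>x \<xi>. (x k * \<xi> k) ^ p - x k * (\<Sum>j\<in>UNIV. x j * \<xi> j) ^ p)"
proof -
  have 1: "has_symbol (\<lambda>f. comp_prod (\<lambda>i g. euler k g + const_poly (b i k - 1) * g) p f) p (\<lambda>x \<xi>. (x k * \<xi> k) ^ p)"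
    using has_symbol_comp_prod[OF has_symbol_euler has_symbol_id] by simp
  have "has_symbol (\<lambda>f. theta (T f)) (Suc d) (\<lambda>x \<xi>. (\<Sum>j\<in>UNIV. x j * \<xi> j) * \<sigma> x \<xi>)" if "has_symbol T d \<sigma>"
    for T :: "'m wop" and d \<sigma>
    unfolding theta_def sum_distrib_right by (intro has_symbol_sum has_symbol_euler that)
  then have "has_symbol (\<lambda>f. comp_prod (\<lambda>i g. theta g + const_poly (a i) * g) p f) (0 + p) (\<lambda>x \<xi>. (\<Sum>j\<in>UNIV. (x::'m\<Rightarrow>complex) j * \<xi> j) ^ p * 1)"
    using has_symbol_id by (rule has_symbol_comp_prod)
  then have 2: "has_symbol (\<lambda>f. const_poly (-1) * (xmon (Poly_Mapping.single k 1) * comp_prod (\<lambda>i g. theta g + const_poly (a i) * g) p f)) p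
     (\<lambda>x \<xi>. (-1) * (x k * (\<Sum>j\<in>UNIV. (x::'m\<Rightarrow>complex) j * \<xi> j) ^ p))"
    by (intro has_symbol_const_mult has_symbol_xmon) simp
  have "const_poly (-1) * g = - g" for g :: "'m cpoly"
    by (rule poly_mapping_eqI) (simp add: lookup_const_poly_times)
  with has_symbol_add[OF 1 2] show ?thesis
    by (simp add: ell_def[abs_def])
qed

lemma ell_in_left_ideal: "ell a b p k \<in> left_ideal_gen (ell a b p)"
proof -
  obtain c where c: "(\<lambda>f. f) = (wop c :: 'a wop)"
    using has_symbol_id by (auto simp: has_symbol_def)
  obtain z where z: "(\<lambda>_. 0) = (wop z :: 'a wop)"
    using has_symbol_zero by (auto simp: has_symbol_def)
  define P where "P = (\<lambda>i. if i = k then \<lambda>f. f else (\<lambda>_. 0) :: 'a wop)"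
  have "\<forall>i. P i \<in> weyl" unfolding P_def weyl_def using c z by auto
  moreover have "ell a b p k = (\<lambda>f. \<Sum>i\<in>UNIV. P i (ell a b p i f))"
    by (rule ext, subst sum.remove[of _ k]) (auto simp: P_def)
  ultimately show ?thesis unfolding left_ideal_gen_def by blast
qed

lemma char_variety_ell:
  fixes x \<xi> :: "'m::finite \<Rightarrow> complex"
  assumes "(x, \<xi>) \<in> char_variety (left_ideal_gen (ell a b p))"
  shows "(x k * \<xi> k) ^ p = x k * (\<Sum>j\<in>UNIV. x j * \<xi> j) ^ p"
proof -
  define \<sigma> where "\<sigma> = (\<lambda>(x::'m \<Rightarrow> complex) \<xi>. (x k * \<xi> k) ^ p - x k * (\<Sum>j\<in>UNIV. x j * \<xi> j) ^ p)"
  obtain c where c: "ell a b p k = wop c" "\<forall>k\<in>Poly_Mapping.keys c. mdeg (snd k) \<le> p" "wsymbol p c = \<sigma>"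
    using has_symbol_ell[of a b p k] by (auto simp: has_symbol_def \<sigma>_def)
  have "\<exists>k\<in>Poly_Mapping.keys c. mdeg (snd k) = p"
  proof (rule ccontr)
    assume "\<not> ?thesis"
    then have "wsymbol p c = (\<lambda>_ _. 0)" by (auto simp: wsymbol_def fun_eq_iff intro!: sum.neutral)
    \<comment> \<open>The left side is \<open>2^p - 2 * 2^p\<close>, which is nonzero, so the order
      is exactly \<open>p\<close>. With all coordinates 1 the two terms would cancel.\<close>
    then have "\<sigma> (\<lambda>_. 2) (\<lambda>j. if j = k then 1 else 0) = 0" by (simp add: c(3))
    moreover have "(\<Sum>j\<in>UNIV. 2 * (if j = k then 1 else 0)) = (2::complex)" 
      by (subst sum.remove[of _ k]) auto
    ultimately show False by (simp add: \<sigma>_def)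
  qed
  then have "word c = p"
    unfolding word_def using c(2) by (intro Max_eqI) (auto simp: image_iff case_prod_beta)
  have "psymbol c x \<xi> = wsymbol p c x \<xi>"
    unfolding psymbol_def wsymbol_def \<open>word c = p\<close>
    by (rule sum.mono_neutral_cong_left) (auto split: if_splits)
  moreover have "psymbol c x \<xi> = 0"
    using assms ell_in_left_ideal[of a b p k] by (auto simp: char_variety_def c(1))
  ultimately show ?thesis by (simp add: c(3) \<sigma>_def)
qed

section \<open>The discriminant polynomial\<close>

lemma peval_add: "peval (f + g) x = peval f x + peval g x"
  unfolding peval_def by (rule setsum_keys_plus_distrib) (simp_all add: distrib_right)

lemma peval_zero [simp]: "peval 0 x = 0"
  by (simp add: peval_def)

lemma peval_sum: "peval (\<Sum>i\<in>S. f i) x = (\<Sum>i\<in>S. peval (f i) x)"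
  by (induction S rule: infinite_finite_induct) (simp_all add: peval_add)

lemma peval_single: "peval (Poly_Mapping.single \<alpha> v) x = v * (\<Prod>i\<in>UNIV. x i ^ lk \<alpha> i)"
  unfolding peval_def by (rule sum_keys_single) simp

lemma peval_mult: "peval (f * g) x = peval f x * peval g x"
proof -
  have "peval (f * g) x = peval (\<Sum>k\<in>Poly_Mapping.keys f. \<Sum>l\<in>Poly_Mapping.keys g. Poly_Mapping.single (k + l) (lk f k * lk g l)) x"
    by (subst (1) poly_mapping_sum_singles[of f], subst (1) poly_mapping_sum_singles[of g])
      (simp add: sum_product mult_single)
  also have "\<dots> = (\<Sum>k\<in>Poly_Mapping.keys f. \<Sum>l\<in>Poly_Mapping.keys g.
      (lk f k * (\<Prod>i\<in>UNIV. x i ^ lk k i)) * (lk g l * (\<Prod>i\<in>UNIV. x i ^ lk l i)))"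
    by (simp add: peval_sum peval_single lookup_add power_add prod.distrib mult_ac)
  also have "\<dots> = peval f x * peval g x"
    by (simp add: peval_def sum_product)
  finally show ?thesis .
qed

lemma peval_one [simp]: "peval 1 x = 1"
  using peval_single[of 0 1 x] by simp

lemma peval_prod: "peval (\<Prod>i\<in>S. f i) x = (\<Prod>i\<in>S. peval (f i) x)"
  by (induction S rule: infinite_finite_induct) (simp_all add: peval_mult)

lemma peval_var: "peval (Poly_Mapping.single (Poly_Mapping.single k 1) v) x = v * x k"
proof -
  have "(\<Prod>i\<in>UNIV. x i ^ lk (Poly_Mapping.single k 1) i) = (\<Prod>i\<in>UNIV. if i = k then x k else 1)"
    by (intro prod.cong) (auto simp: lookup_single)
  then show ?thesis by (simp only: peval_single prod.delta finite_UNIV) simp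
qed

lemma mdeg_le_pdeg: "\<alpha> \<in> Poly_Mapping.keys q \<Longrightarrow> mdeg \<alpha> \<le> pdeg q"
  unfolding pdeg_def by (intro Max_ge) auto

section \<open>Roots of unity\<close>

abbreviation roots1 :: "nat \<Rightarrow> complex set" where
  "roots1 p \<equiv> {z. z ^ p = 1}"

lemma zeta_power: "zeta p ^ k = cis (2 * pi * real k / real p)"
proof -
  have "zeta p = cis (2 * pi / real p)"
    by (simp add: zeta_def cis_conv_exp mult_ac)
  then show ?thesis by (simp add: Complex.DeMoivre mult_ac)
qed

lemma zeta_power_self: "1 \<le> p \<Longrightarrow> zeta p ^ p = 1"
  by (simp add: zeta_power)

text \<open>The exponent \<open>p\<close> takes the place of 0 in the usual range
  \<open>{..<p}\<close>; injectivity then follows by counting.\<close>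

lemma bij_betw_zeta:
  assumes p: "1 \<le> p"
  shows "bij_betw (\<lambda>i. zeta p ^ i) {1..p} (roots1 p)"
proof -
  have b: "bij_betw (\<lambda>i. zeta p ^ i) {..<p} (roots1 p)"
    using Complex.bij_betw_roots_unity[of p] p by (simp add: zeta_power)
  have "(\<lambda>i. zeta p ^ i) ` {1..p} = (\<lambda>i. zeta p ^ i) ` {..<p}"
  proof (intro equalityI image_subsetI)
    fix i assume "i \<in> {1..p}"
    then show "zeta p ^ i \<in> (\<lambda>i. zeta p ^ i) ` {..<p}"
      using p zeta_power_self[OF p] by (cases "i = p") (auto intro: image_eqI[of _ _ 0])
  next
    fix i assume "i \<in> {..<p}"
    then show "zeta p ^ i \<in> (\<lambda>i. zeta p ^ i) ` {1..p}"
      using p zeta_power_self[OF p] by (cases "i = 0") (auto intro: image_eqI[of _ _ p])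
  qed
  then have im: "(\<lambda>i. zeta p ^ i) ` {1..p} = roots1 p" using b by (simp add: bij_betw_def)
  have "card (roots1 p) = card {1..p}"
    using card_roots_unity_eq[of p] p by simp
  then have "inj_on (\<lambda>i. zeta p ^ i) {1..p}"
    by (intro eq_card_imp_inj_on) (simp_all only: im finite_atLeastAtMost)
  with im show ?thesis by (simp add: bij_betw_def)
qed

lemma finite_roots1: "1 \<le> p \<Longrightarrow> finite (roots1 p)"
  using bij_betw_finite[OF bij_betw_zeta] by simp

lemma card_roots1: "1 \<le> p \<Longrightarrow> card (roots1 p) = p"
  using bij_betw_same_card[OF bij_betw_zeta] by simp

text \<open>Multiplication by \<open>zeta p\<close> permutes the roots and multiplies the sum by
  \<open>zeta p ^ n\<close>, which differs from 1 unless \<open>p\<close> divides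
  \<open>n\<close>.\<close>

lemma sum_roots1_power:
  assumes p: "1 \<le> p"
  shows "(\<Sum>w\<in>roots1 p. w ^ n) = (if p dvd n then of_nat p else 0)"
proof (cases "p dvd n")
  case True
  then have "w ^ n = 1" if "w \<in> roots1 p" for w
    using that by (auto elim!: dvdE simp: power_mult)
  then show ?thesis using True by (simp add: card_roots1[OF p])
next
  case False
  define z where "z = zeta p"
  have z: "z ^ p = 1" using zeta_power_self[OF p] by (simp add: z_def)
  then have z0: "z \<noteq> 0" using p by (auto simp: zero_power)
  have "z ^ n = z ^ (p * (n div p) + n mod p)"
    by (simp only: mult_div_mod_eq)
  also have "\<dots> = z ^ (n mod p)"
    by (simp only: power_add power_mult z power_one mult_1_left)
  finally have "z ^ n = z ^ (n mod p)" .
  moreover have "z ^ (n mod p) \<noteq> z ^ p"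
  proof
    assume "z ^ (n mod p) = z ^ p"
    then have eq: "zeta p ^ (n mod p) = zeta p ^ p" by (simp add: z_def)
    have "n mod p \<in> {1..p}" using False p mod_less_divisor[of p n]
      by (simp add: Suc_le_eq dvd_eq_mod_eq_0 less_imp_le)
    moreover have "p \<in> {1..p}" using p by simp
    ultimately have "n mod p = p"
      by (rule inj_onD[OF bij_betw_imp_inj_on[OF bij_betw_zeta[OF p]] eq])
    then show False using p mod_less_divisor[of p n] by simp
  qed
  ultimately have zn: "z ^ n \<noteq> 1" using z by simp
  have "(\<Sum>w\<in>roots1 p. w ^ n) = (\<Sum>w\<in>roots1 p. (z * w) ^ n)"
    by (rule sum.reindex_bij_witness[of _ "\<lambda>w. z * w" "\<lambda>w. w / z"])
      (auto simp: z z0 power_mult_distrib power_divide)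
  also have "\<dots> = z ^ n * (\<Sum>w\<in>roots1 p. w ^ n)"
    by (simp add: power_mult_distrib sum_distrib_left)
  finally have "(\<Sum>w\<in>roots1 p. w ^ n) = z ^ n * (\<Sum>w\<in>roots1 p. w ^ n)" .
  with zn show ?thesis using False by auto
qed

text \<open>\<open>R\<close> as a function of \<open>p\<close>-th roots \<open>y_k\<close> of the
  \<open>x_k\<close>; in these it is visibly a polynomial.\<close>

definition Rroot :: "nat \<Rightarrow> ('m::finite \<Rightarrow> complex) \<Rightarrow> complex" where
  "Rroot p y = (\<Prod>r\<in>UNIV \<rightarrow>\<^sub>E roots1 p. 1 - (\<Sum>k\<in>UNIV. r k * y k))"

lemma Rfun_eq_Rroot:
  assumes p: "1 \<le> p"
  shows "Rfun p x = Rroot p (\<lambda>k. x k powr (1 / of_nat p))"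
proof -
  let ?f = "\<lambda>i. zeta p ^ i"
  note b = bij_betw_zeta[OF p]
  have inv: "inv_into {1..p} ?f z \<in> {1..p}" "?f (inv_into {1..p} ?f z) = z" if "z \<in> roots1 p" for z
    using bij_betw_apply[OF bij_betw_inv_into[OF b] that] bij_betw_inv_into_right[OF b that] by simp_all
  show ?thesis
    unfolding Rfun_def Rroot_def
  proof (rule prod.reindex_bij_witness[of _ "\<lambda>r k. inv_into {1..p} ?f (r k)" "\<lambda>j k. ?f (j k)"], goal_cases)
    case (1 j)
    then show ?case using bij_betw_inv_into_left[OF b] by (auto simp: fun_eq_iff PiE_iff)
  next
    case (2 j)
    then show ?case using bij_betw_apply[OF b] by (auto simp: PiE_iff)
  next
    case (3 r)
    then show ?case using inv by (auto simp: fun_eq_iff PiE_iff)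
  next
    case (4 r)
    then show ?case using inv by (auto simp: PiE_iff)
  qed simp
qed

text \<open>Multiplication by \<open>w\<close> permutes the tuples indexing the product. Hence the
  choice of the \<open>p\<close>-th roots does not matter.\<close>

lemma Rroot_mult_roots1:
  assumes p: "1 \<le> p" and w: "w \<in> UNIV \<rightarrow>\<^sub>E roots1 p"
  shows "Rroot p (\<lambda>k. w k * y k) = Rroot p y"
proof -
  have w1: "w k ^ p = 1" "w k \<noteq> 0" for k
    using w p by (auto simp: PiE_iff zero_power dest!: spec[of _ k])
  show ?thesis
    unfolding Rroot_def
    by (rule prod.reindex_bij_witness[of _ "\<lambda>r k. r k / w k" "\<lambda>r k. r k * w k"])
      (auto simp: PiE_iff w1 power_mult_distrib power_divide mult.assoc)
qed

definition Rroot_poly :: "nat \<Rightarrow> 'm::finite cpoly" where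
  "Rroot_poly p = (\<Prod>r\<in>UNIV \<rightarrow>\<^sub>E roots1 p. 1 + (\<Sum>k\<in>UNIV. Poly_Mapping.single (Poly_Mapping.single k 1) (- r k)))"

lemma peval_Rroot_poly: "peval (Rroot_poly p) y = Rroot p y"
  unfolding Rroot_poly_def Rroot_def peval_prod peval_add peval_sum peval_var
  by (simp add: sum_negf)

lemma mdeg_keys_prod:
  fixes f :: "'i \<Rightarrow> 'm::finite cpoly"
  assumes "\<And>i \<alpha>. i \<in> S \<Longrightarrow> \<alpha> \<in> Poly_Mapping.keys (f i) \<Longrightarrow> mdeg \<alpha> \<le> 1"
  shows "\<alpha> \<in> Poly_Mapping.keys (\<Prod>i\<in>S. f i) \<Longrightarrow> mdeg \<alpha> \<le> card S"
  using assms
proof (induction S arbitrary: \<alpha> rule: infinite_finite_induct)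
  case (insert i S)
  then have "\<alpha> \<in> Poly_Mapping.keys (f i * (\<Prod>i\<in>S. f i))" by simp
  then obtain \<beta> \<gamma> where "\<beta> \<in> Poly_Mapping.keys (f i)" "\<gamma> \<in> Poly_Mapping.keys (\<Prod>i\<in>S. f i)" "\<alpha> = \<beta> + \<gamma>"
    using keys_mult by blast
  then have "mdeg \<beta> \<le> 1" "mdeg \<gamma> \<le> card S" "mdeg \<alpha> = mdeg \<beta> + mdeg \<gamma>"
    using insert by (auto simp: mdeg_add)
  then show ?case using insert.hyps by simp
qed (auto simp: mdeg_def)

lemma mdeg_Rroot_poly:
  fixes \<alpha> :: "'m::finite mon"
  assumes p: "1 \<le> p" and "\<alpha> \<in> Poly_Mapping.keys (Rroot_poly p)"
  shows "mdeg \<alpha> \<le> p ^ CARD('m)"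
proof -
  have "mdeg \<beta> \<le> 1" if "\<beta> \<in> Poly_Mapping.keys (1 + (\<Sum>k\<in>UNIV. Poly_Mapping.single (Poly_Mapping.single k 1) (- r k)))"
    for \<beta> and r :: "'m \<Rightarrow> complex"
  proof -
    have "\<beta> \<in> Poly_Mapping.keys (1 :: 'm cpoly) \<or> \<beta> \<in> Poly_Mapping.keys (\<Sum>k\<in>UNIV. Poly_Mapping.single (Poly_Mapping.single k 1) (- r k))"
      using subsetD[OF Poly_Mapping.keys_add that] by blast
    then have "\<beta> = 0 \<or> (\<exists>k. \<beta> = Poly_Mapping.single k 1)"
    proof
      assume "\<beta> \<in> Poly_Mapping.keys (\<Sum>k\<in>UNIV. Poly_Mapping.single (Poly_Mapping.single k 1) (- r k))"
      from subsetD[OF Poly_Mapping.keys_sum this]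
      obtain k where "\<beta> \<in> Poly_Mapping.keys (Poly_Mapping.single (Poly_Mapping.single k 1) (- r k))"
        by blast
      then show ?thesis by (auto split: if_splits)
    qed simp
    then show ?thesis by (auto simp: mdeg_def)
  qed
  from mdeg_keys_prod[OF this assms(2)[unfolded Rroot_poly_def]]
  have "mdeg \<alpha> \<le> card ((UNIV :: 'm set) \<rightarrow>\<^sub>E roots1 p)" .
  then show ?thesis by (simp add: card_PiE card_roots1[OF p])
qed

text \<open>Selecting the monomials in the \<open>p\<close>-th powers avoids showing separately that
  the others cancel; the averaging below removes them.\<close>

definition Rpoly :: "nat \<Rightarrow> 'm::finite cpoly" where
  "Rpoly p = (\<Sum>\<alpha>\<in>{\<alpha>\<in>Poly_Mapping.keys (Rroot_poly p). \<forall>i. p dvd lk \<alpha> i}.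
     Poly_Mapping.single (mon_of (\<lambda>i. lk \<alpha> i div p)) (lk (Rroot_poly p) \<alpha>))"

text \<open>\<open>Rroot_poly p\<close> is invariant under multiplying each variable by a \<open>p\<close>-th root of unity;
  averaging over these substitutions leaves only the monomials in the \<open>p\<close>-th powers.\<close>

lemma peval_Rpoly:
  fixes y :: "'m::finite \<Rightarrow> complex"
  assumes p: "1 \<le> p"
  shows "peval (Rpoly p) (\<lambda>i. y i ^ p) = Rroot p y"
proof -
  let ?G = "Rroot_poly p :: 'm cpoly"
  let ?W = "(UNIV :: 'm set) \<rightarrow>\<^sub>E roots1 p"
  let ?dv = "\<lambda>\<alpha> :: 'm mon. \<forall>i. p dvd lk \<alpha> i"
  have avg: "(\<Sum>w\<in>?W. \<Prod>i\<in>UNIV. w i ^ lk \<alpha> i) = (if ?dv \<alpha> then of_nat (p ^ CARD('m)) else 0)" for \<alpha> :: "'m mon"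
  proof -
    have "(\<Sum>w\<in>?W. \<Prod>i\<in>UNIV. w i ^ lk \<alpha> i) = (\<Prod>i\<in>(UNIV::'m set). \<Sum>w\<in>roots1 p. w ^ lk \<alpha> i)"
      by (rule prod_sum_PiE[symmetric]) (simp_all add: finite_roots1[OF p])
    also have "\<dots> = (\<Prod>i\<in>(UNIV::'m set). if p dvd lk \<alpha> i then of_nat p else 0)"
      by (simp only: sum_roots1_power[OF p])
    also have "\<dots> = (if ?dv \<alpha> then of_nat (p ^ CARD('m)) else 0)"
      by (auto intro!: prod_zero)
    finally show ?thesis .
  qed
  have pm: "of_nat (p ^ CARD('m)) \<noteq> (0 :: complex)" using p by simp
  have cW: "card ?W = p ^ CARD('m)" by (simp add: card_PiE card_roots1[OF p])
  have "of_nat (p ^ CARD('m)) * Rroot p y = (\<Sum>w\<in>?W. Rroot p (\<lambda>k. w k * y k))"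
    by (simp add: Rroot_mult_roots1[OF p] cW)
  also have "\<dots> = (\<Sum>w\<in>?W. \<Sum>\<alpha>\<in>Poly_Mapping.keys ?G. lk ?G \<alpha> * (\<Prod>i\<in>UNIV. y i ^ lk \<alpha> i) * (\<Prod>i\<in>UNIV. w i ^ lk \<alpha> i))"
    unfolding peval_Rroot_poly[symmetric] peval_def by (simp add: power_mult_distrib prod.distrib mult_ac)
  also have "\<dots> = (\<Sum>\<alpha>\<in>Poly_Mapping.keys ?G. lk ?G \<alpha> * (\<Prod>i\<in>UNIV. y i ^ lk \<alpha> i) * (if ?dv \<alpha> then of_nat (p ^ CARD('m)) else 0))"
    by (subst sum.swap) (simp only: sum_distrib_left[symmetric] avg)
  also have "\<dots> = (\<Sum>\<alpha>\<in>{\<alpha>\<in>Poly_Mapping.keys ?G. ?dv \<alpha>}. lk ?G \<alpha> * (\<Prod>i\<in>UNIV. y i ^ lk \<alpha> i) * of_nat (p ^ CARD('m)))"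
    by (rule sum.mono_neutral_cong_right) auto
  also have "\<dots> = of_nat (p ^ CARD('m)) * peval (Rpoly p) (\<lambda>i. y i ^ p)"
  proof -
    have "(\<Prod>i\<in>UNIV. (y i ^ p) ^ (lk \<alpha> i div p)) = (\<Prod>i\<in>UNIV. y i ^ lk \<alpha> i)" if "?dv \<alpha>" for \<alpha>
      using that by (intro prod.cong) (auto simp: power_mult[symmetric])
    then show ?thesis
      unfolding Rpoly_def peval_sum peval_single lookup_mon_of sum_distrib_left
      by (intro sum.cong) auto
  qed
  finally show ?thesis using pm by simp
qed

lemma powr_inverse_power: "1 \<le> p \<Longrightarrow> (z powr (1 / of_nat p)) ^ p = (z :: complex)"
  by (cases "z = 0") (simp_all add: powr_def exp_of_nat_mult[symmetric])

lemma peval_Rpoly_Rfun: "1 \<le> p \<Longrightarrow> peval (Rpoly p) x = Rfun p x"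
  using peval_Rpoly[of p "\<lambda>k. x k powr (1 / of_nat p)"]
  by (simp add: Rfun_eq_Rroot powr_inverse_power)

text \<open>Upper bound: \<open>Rroot_poly\<close> is a product of \<open>p^m\<close> factors of
  degree at most 1, and degrees are divided by \<open>p\<close>. Lower bound: on a coordinate axis
  the factors become \<open>1 - w s\<close> with \<open>w \<noteq> 0\<close>, giving degree exactly
  \<open>p^m\<close> in \<open>s\<close> and so \<open>p^(m-1)\<close> in
  \<open>s^p\<close>.\<close>

lemma pdeg_Rpoly:
  assumes p: "1 \<le> p"
  shows "pdeg (Rpoly p :: 'm::finite cpoly) = p ^ (CARD('m) - 1)"
proof (rule antisym)
  let ?q = "Rpoly p :: 'm cpoly"
  have pm: "p ^ CARD('m) = p * p ^ (CARD('m) - 1)"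
    by (simp add: power_Suc[symmetric] del: power_Suc)
  have "mdeg \<beta> \<le> p ^ (CARD('m) - 1)" if \<beta>: "\<beta> \<in> Poly_Mapping.keys ?q" for \<beta>
  proof -
    obtain \<alpha> where \<alpha>: "\<alpha> \<in> Poly_Mapping.keys (Rroot_poly p)" "\<forall>i. p dvd lk \<alpha> i"
      "\<beta> = mon_of (\<lambda>i. lk \<alpha> i div p)"
      using subsetD[OF Poly_Mapping.keys_sum \<beta>[unfolded Rpoly_def]] by (auto split: if_splits)
    have "p * mdeg \<beta> = mdeg \<alpha>"
      using \<alpha>(2) by (simp add: \<alpha>(3) mdeg_UNIV sum_distrib_left)
    with mdeg_Rroot_poly[OF p \<alpha>(1)] have "p * mdeg \<beta> \<le> p * p ^ (CARD('m) - 1)" by (simp only: pm)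
    with p show ?thesis by simp
  qed
  then show "pdeg ?q \<le> p ^ (CARD('m) - 1)"
    unfolding pdeg_def by (intro Max.boundedI) auto
next
  let ?q = "Rpoly p :: 'm cpoly"
  let ?k = "undefined :: 'm"
  have pm: "p ^ CARD('m) = p * p ^ (CARD('m) - 1)"
    by (simp add: power_Suc[symmetric] del: power_Suc)
  \<comment> \<open>The restriction of \<open>Rpoly\<close> to the axis of an arbitrarily chosen
    coordinate \<open>?k\<close>, as a univariate polynomial.\<close>
  define r where "r = (\<Sum>\<alpha>\<in>Poly_Mapping.keys ?q. monom (if \<forall>i. i \<noteq> ?k \<longrightarrow> lk \<alpha> i = 0 then lk ?q \<alpha> else 0) (lk \<alpha> ?k))"
  have deg_r: "degree r \<le> pdeg ?q"
    unfolding r_def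
  proof (rule degree_sum_le)
    fix \<alpha> assume "\<alpha> \<in> Poly_Mapping.keys ?q"
    then have "mdeg \<alpha> \<le> pdeg ?q" by (rule mdeg_le_pdeg)
    moreover have "lk \<alpha> ?k \<le> mdeg \<alpha>" by (simp add: mdeg_UNIV member_le_sum)
    ultimately show "degree (monom (if \<forall>i. i \<noteq> ?k \<longrightarrow> lk \<alpha> i = 0 then lk ?q \<alpha> else 0) (lk \<alpha> ?k)) \<le> pdeg ?q"
      by (meson degree_monom_le order_trans)
  qed simp
  have poly_r: "poly r t = peval ?q (\<lambda>i. if i = ?k then t else 0)" for t
  proof -
    have "(if \<forall>i. i \<noteq> ?k \<longrightarrow> lk \<alpha> i = 0 then lk ?q \<alpha> else 0) * t ^ lk \<alpha> ?k
      = lk ?q \<alpha> * (\<Prod>i\<in>UNIV. (if i = ?k then t else 0) ^ lk \<alpha> i)" for \<alpha>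
    proof -
      have if_mult: "(if P then c else 0) * u = c * (u * (if P then 1 else 0))" for P and c u :: complex
        by simp
      have "(\<Prod>i\<in>UNIV. (if i = ?k then t else 0) ^ lk \<alpha> i) = t ^ lk \<alpha> ?k * (\<Prod>i\<in>UNIV - {?k}. 0 ^ lk \<alpha> i)"
        by (subst prod.remove[of _ ?k]) auto
      also have "(\<Prod>i\<in>UNIV - {?k}. 0 ^ lk \<alpha> i) = (if \<forall>i. i \<noteq> ?k \<longrightarrow> lk \<alpha> i = 0 then 1 else (0::complex))"
        by (auto simp: zero_power intro!: prod_zero)
      finally show ?thesis
        by (simp only: if_mult)
    qed
    then show ?thesis by (simp add: r_def poly_sum poly_monom peval_def)
  qed
  define S where "S = (\<Prod>w\<in>(UNIV :: 'm set) \<rightarrow>\<^sub>E roots1 p. [:1, - w ?k:])"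
  have "poly (r \<circ>\<^sub>p monom 1 p) s = poly S s" for s
  proof -
    have "poly (r \<circ>\<^sub>p monom 1 p) s = peval ?q (\<lambda>i. (if i = ?k then s else 0) ^ p)"
    proof -
      have "(\<lambda>i. (if i = ?k then s else 0) ^ p) = (\<lambda>i. if i = ?k then s ^ p else 0)"
        using p by (auto simp: zero_power)
      then show ?thesis by (simp only: poly_pcompose poly_monom poly_r mult_1)
    qed
    also have "\<dots> = (\<Prod>w\<in>(UNIV :: 'm set) \<rightarrow>\<^sub>E roots1 p. 1 - w ?k * s)"
      unfolding peval_Rpoly[OF p] Rroot_def by (simp add: if_distrib sum.delta cong: if_cong)
    also have "\<dots> = poly S s" by (simp add: S_def poly_prod mult.commute)
    finally show ?thesis .
  qed
  then have "r \<circ>\<^sub>p monom 1 p = S" by (simp add: poly_eq_poly_eq_iff[symmetric] fun_eq_iff)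
  moreover have "degree (r \<circ>\<^sub>p monom 1 p) = degree r * p"
    by (simp add: degree_pcompose degree_monom_eq)
  moreover have "degree S = p ^ CARD('m)"
  proof -
    have nz: "w ?k \<noteq> 0" if "w \<in> (UNIV :: 'm set) \<rightarrow>\<^sub>E roots1 p" for w
      using that p by (auto simp: PiE_iff zero_power dest!: spec[of _ ?k])
    have "degree S = (\<Sum>w\<in>(UNIV :: 'm set) \<rightarrow>\<^sub>E roots1 p. degree [:1, - w ?k:])"
      unfolding S_def by (rule degree_prod_eq_sum_degree) simp
    also have "\<dots> = (\<Sum>w\<in>(UNIV :: 'm set) \<rightarrow>\<^sub>E roots1 p. 1)"
      using nz by (intro sum.cong) auto
    finally show ?thesis by (simp add: card_PiE card_roots1[OF p])
  qed
  ultimately have "degree r * p = p * p ^ (CARD('m) - 1)" by (simp only: pm)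
  with p deg_r show "p ^ (CARD('m) - 1) \<le> pdeg ?q" by simp
qed

section \<open>The singular locus\<close>

text \<open>Coordinates are released one at a time: in the induction, those in \<open>S\<close> are
  arbitrary and the others are positive integers.\<close>

lemma separately_polyfun_eq_zero:
  fixes f :: "('m::finite \<Rightarrow> complex) \<Rightarrow> complex"
  assumes poly: "\<And>y k. polyfun (\<lambda>t. f (y(k := t)))"
    and zero: "\<And>e :: 'm \<Rightarrow> nat. (\<And>i. 0 < e i) \<Longrightarrow> f (\<lambda>i. of_nat (e i)) = 0"
  shows "f y = 0"
proof -
  have "\<forall>y. (\<forall>i. i \<notin> S \<longrightarrow> (\<exists>n>0. y i = of_nat n)) \<longrightarrow> f y = 0" for S :: "'m set"
  proof (induction S rule: finite_induct[OF finite])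
    case 1
    show ?case
    proof (intro allI impI)
      fix y :: "'m \<Rightarrow> complex" assume "\<forall>i. i \<notin> {} \<longrightarrow> (\<exists>n>0. y i = of_nat n)"
      then obtain e where e: "\<And>i. e i > 0 \<and> y i = of_nat (e i)" by (metis empty_iff)
      then have "y = (\<lambda>i. of_nat (e i))" by auto
      with zero[of e] e show "f y = 0" by simp
    qed
  next
    case (2 k S)
    show ?case
    proof (intro allI impI)
      fix y :: "'m \<Rightarrow> complex" assume y: "\<forall>i. i \<notin> insert k S \<longrightarrow> (\<exists>n>0. y i = of_nat n)"
      have "f (y(k := y k)) = 0"
      proof (rule polyfun_eq_zero[OF poly])
        fix N :: nat assume N: "1 \<le> N"
        have "\<forall>i. i \<notin> S \<longrightarrow> (\<exists>n>0. (y(k := of_nat N)) i = of_nat n)"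
          using y N by (auto intro!: exI[of _ N])
        with 2(3) show "f (y(k := of_nat N)) = 0" by blast
      qed
      then show "f y = 0" by simp
    qed
  qed
  from this[of UNIV] show ?thesis by simp
qed

text \<open>Zariski density of the points supplied by \<open>psymbol_on_torus\<close> in the image
  of the hyperplane \<open>\<Sum> y_i = 1\<close> under \<open>p\<close>-th powers.\<close>

lemma polynomial_vanishes_on_Rroot:
  fixes g :: "'m::finite cpoly"
  assumes g: "\<And>e :: 'm \<Rightarrow> nat. (\<And>i. 0 < e i) \<Longrightarrow>
      peval g (\<lambda>i. (of_nat (e i) / of_nat (\<Sum>i\<in>UNIV. e i)) ^ p) = 0"
    and y: "(\<Sum>i\<in>UNIV. y i) = 1"
  shows "peval g (\<lambda>i. y i ^ p) = 0"
proof -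
  define D where "D = pdeg g"
  \<comment> \<open>Homogenising makes the vanishing at rational points of the simplex one on positive integers.\<close>
  define H where "H = (\<lambda>y :: 'm \<Rightarrow> complex. \<Sum>\<alpha>\<in>Poly_Mapping.keys g. lk g \<alpha> *
    (\<Prod>i\<in>UNIV. (y i ^ p) ^ lk \<alpha> i) * ((\<Sum>i\<in>UNIV. y i) ^ p) ^ (D - mdeg \<alpha>))"
  have "H y = 0"
  proof (rule separately_polyfun_eq_zero[of H])
    fix y :: "'m \<Rightarrow> complex" and k
    have "polyfun (\<lambda>t. (y(k := t)) i)" for i
      by (cases "i = k") (simp_all add: polyfun_ident polyfun_const)
    then show "polyfun (\<lambda>t. H (y(k := t)))"
      unfolding H_def by (intro polyfun_sum polyfun_mult polyfun_const polyfun_prod polyfun_power)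
  next
    fix e :: "'m \<Rightarrow> nat" assume e: "\<And>i. 0 < e i"
    define S :: complex where "S = of_nat (\<Sum>i\<in>UNIV. e i)"
    have "(\<Sum>i\<in>UNIV. e i) \<noteq> 0" using e by (auto simp: sum_eq_0_iff)
    then have S: "S \<noteq> 0" unfolding S_def of_nat_eq_0_iff .
    have "H (\<lambda>i. of_nat (e i)) = (S ^ p) ^ D * peval g (\<lambda>i. (of_nat (e i) / S) ^ p)"
      unfolding H_def peval_def sum_distrib_left
    proof (rule sum.cong[OF refl])
      fix \<alpha> assume "\<alpha> \<in> Poly_Mapping.keys g"
      then have "mdeg \<alpha> \<le> D" unfolding D_def by (rule mdeg_le_pdeg)
      then have "(S ^ p) ^ D = (S ^ p) ^ (D - mdeg \<alpha>) * (S ^ p) ^ mdeg \<alpha>"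
        by (simp only: power_add[symmetric] le_add_diff_inverse2)
      moreover have "(S ^ p) ^ mdeg \<alpha> * (\<Prod>i\<in>UNIV. ((of_nat (e i) / S) ^ p) ^ lk \<alpha> i) = (\<Prod>i\<in>UNIV. (of_nat (e i) ^ p) ^ lk \<alpha> i)"
        unfolding mdeg_UNIV power_sum prod.distrib[symmetric] power_mult_distrib[symmetric]
        using S by simp
      ultimately show "lk g \<alpha> * (\<Prod>i\<in>UNIV. (of_nat (e i) ^ p) ^ lk \<alpha> i) * ((\<Sum>i\<in>UNIV. of_nat (e i)) ^ p) ^ (D - mdeg \<alpha>)
        = (S ^ p) ^ D * (lk g \<alpha> * (\<Prod>i\<in>UNIV. ((of_nat (e i) / S) ^ p) ^ lk \<alpha> i))"
        by (simp add: S_def mult_ac)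
    qed
    then show "H (\<lambda>i. of_nat (e i)) = 0" using g[OF e] by (simp add: S_def)
  qed
  then show ?thesis by (simp add: H_def peval_def y)
qed

lemma char_variety_imp_discriminant:
  fixes x \<xi> :: "'m::finite \<Rightarrow> complex"
  assumes p: "1 \<le> p"
    and ch: "(x, \<xi>) \<in> char_variety (left_ideal_gen (ell a b p))" and \<xi>: "\<xi> \<noteq> (\<lambda>_. 0)"
  shows "(\<Prod>k\<in>UNIV. x k) * Rfun p x = 0"
proof (cases "\<forall>k. x k \<noteq> 0")
  case True
  define s where "s = (\<Sum>j\<in>UNIV. x j * \<xi> j)"
  have eq: "(x k * \<xi> k) ^ p = x k * s ^ p" for k
    using char_variety_ell[OF ch] by (simp add: s_def)
  have "s \<noteq> 0"
  proof
    assume "s = 0"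
    then have "\<xi> k = 0" for k using eq[of k] True p by (simp add: zero_power)
    with \<xi> show False by auto
  qed
  define y where "y = (\<lambda>k. x k powr (1 / of_nat p))"
  have y: "y k ^ p = x k" for k using p by (simp add: y_def powr_inverse_power)
  then have y0: "y k \<noteq> 0" for k using True p by (metis zero_power not_one_le_zero neq0_conv)
  \<comment> \<open>The root of unity relating the \<open>p\<close>-th root
    \<open>x_k \<xi>_k / s\<close> of \<open>x_k\<close> to the principal branch
    \<open>y k\<close>.\<close>
  define r where "r = (\<lambda>k. x k * \<xi> k / s / y k)"
  have "r k ^ p = (x k * \<xi> k) ^ p / s ^ p / y k ^ p" for k
    by (simp only: r_def power_divide)
  then have "r k ^ p = 1" for k
    unfolding eq y using \<open>s \<noteq> 0\<close> True by simp
  then have "r \<in> UNIV \<rightarrow>\<^sub>E roots1 p" by auto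
  moreover have "(\<Sum>k\<in>UNIV. r k * y k) = 1"
    using \<open>s \<noteq> 0\<close> y0 by (simp add: r_def sum_divide_distrib[symmetric] s_def[symmetric])
  ultimately have "Rroot p y = 0"
    unfolding Rroot_def by (intro prod_zero finite_PiE) (auto simp: finite_roots1[OF p])
  then show ?thesis by (simp add: Rfun_eq_Rroot[OF p] y_def)
next
  case False
  then show ?thesis by auto
qed

theorem mainTheorem6:
  fixes a :: "nat \<Rightarrow> complex" and b :: "nat \<Rightarrow> 'm::finite \<Rightarrow> complex" and p :: nat
  assumes p_pos: "p \<ge> 1"
    and b_nonpos: "\<forall>j k. 1 \<le> j \<and> j \<le> p - 1 \<longrightarrow> (\<forall>n::nat. b j k \<noteq> - of_nat n)"
    and b_last: "\<forall>k. b p k = 1"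
    and C1: "\<forall>i\<in>{1..p}. \<forall>j\<in>(UNIV::'m set) \<rightarrow>\<^sub>E {1..p}. a i - (\<Sum>k\<in>UNIV. b (j k) k) \<notin> \<int>"
    and C2: "\<forall>k. \<forall>j j'. 1 \<le> j \<and> j < j' \<and> j' \<le> p \<longrightarrow> b j k - b j' k \<notin> \<int>"
  shows "sing_locus (left_ideal_gen (ell a b p)) = {x. (\<Prod>k\<in>UNIV. x k) * Rfun p x = 0}
         \<and> (\<exists>q::'m cpoly. (\<forall>x. peval q x = Rfun p x) \<and> pdeg q = p ^ (CARD('m) - 1))"
proof
  let ?I = "left_ideal_gen (ell a b p)"
  let ?Ch = "fst ` (char_variety ?I - {(x,\<xi>). \<xi> = (\<lambda>_. 0)})"
  have A: "Apol b p k (of_nat j) \<noteq> 0" if "0 < j" for k j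
    using b_nonpos b_last that by (rule Apol_nonzero)
  have A0: "Apol b p k 0 = 0" for k
    using p_pos b_last by (rule Apol_0)
  have "a i \<notin> \<int>" if "i \<in> {1..p}" for i
  proof
    assume "a i \<in> \<int>"
    \<comment> \<open>For this constant choice of indices all \<open>b\<close> equal 1, so (C1) says
      that \<open>a i\<close> minus an integer is not an integer.\<close>
    moreover have "(\<lambda>_. p) \<in> (UNIV::'m set) \<rightarrow>\<^sub>E {1..p}" using p_pos by auto
    from C1[THEN bspec, OF that, THEN bspec, OF this]
    have "a i - of_nat CARD('m) \<notin> \<int>" using b_last by simp
    ultimately show False by simp
  qed
  then have B: "Bpol a p (of_nat j) \<noteq> 0" for j by (intro Bpol_nonzero) blast
  show "sing_locus ?I = {x. (\<Prod>k\<in>UNIV. x k) * Rfun p x = 0}"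
  proof (intro equalityI subsetI)
    fix x assume x: "x \<in> sing_locus ?I"
    \<comment> \<open>Test polynomial for the closure: it vanishes on the projection, hence at
      \<open>x\<close>.\<close>
    define Q :: "'m cpoly" where "Q = (\<Prod>k\<in>UNIV. Poly_Mapping.single (Poly_Mapping.single k 1) 1) * Rpoly p"
    have Q: "peval Q x = (\<Prod>k\<in>UNIV. x k) * Rfun p x" for x
      unfolding Q_def peval_mult peval_prod peval_var peval_Rpoly_Rfun[OF p_pos] by simp
    have "peval Q y = 0" if "y \<in> ?Ch" for y
      using that char_variety_imp_discriminant[OF p_pos] unfolding Q by force
    with x have "peval Q x = 0" by (auto simp: sing_locus_def zariski_closure_def)
    then show "x \<in> {x. (\<Prod>k\<in>UNIV. x k) * Rfun p x = 0}" by (simp only: Q mem_Collect_eq)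
  next
    fix x :: "'m \<Rightarrow> complex" assume "x \<in> {x. (\<Prod>k\<in>UNIV. x k) * Rfun p x = 0}"
    then consider \<kappa> where "x \<kappa> = 0" | "Rfun p x = 0" by auto
    then show "x \<in> sing_locus ?I"
    proof cases
      case 1
      define \<xi> :: "'m \<Rightarrow> complex" where "\<xi> = (\<lambda>i. if i = \<kappa> then 1 else 0)"
      have "(x, \<xi>) \<in> char_variety ?I"
        unfolding char_variety_def \<xi>_def using psymbol_boundary[where x = x and \<kappa> = \<kappa>, OF A A0 _ 1] by auto
      moreover have "\<xi> \<noteq> (\<lambda>_. 0)" by (auto simp: \<xi>_def fun_eq_iff)
      \<comment> \<open>Points on the hyperplanes lie in the projection itself; in the other case
        only the closure is reached.\<close>
      ultimately have "x \<in> ?Ch" by force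
      then show ?thesis by (auto simp: sing_locus_def zariski_closure_def)
    next
      case 2
      define y where "y = (\<lambda>k. x k powr (1 / of_nat p))"
      from 2 have "Rroot p y = 0" by (simp add: Rfun_eq_Rroot[OF p_pos] y_def)
      \<comment> \<open>A vanishing factor of the product yields \<open>p\<close>-th roots
        \<open>r k * y k\<close> of the \<open>x k\<close> with sum 1.\<close>
      then obtain r where r: "r \<in> (UNIV::'m set) \<rightarrow>\<^sub>E roots1 p" "(\<Sum>k\<in>UNIV. r k * y k) = 1"
        unfolding Rroot_def by (auto simp: prod_zero_iff finite_PiE finite_roots1[OF p_pos])
      have x: "x = (\<lambda>k. (r k * y k) ^ p)"
        using r(1) p_pos by (auto simp: PiE_iff power_mult_distrib y_def powr_inverse_power)
      have "peval g x = 0" if g: "\<forall>y\<in>?Ch. peval g y = 0" for g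
        unfolding x
      proof (rule polynomial_vanishes_on_Rroot[OF _ r(2)])
        fix e :: "'m \<Rightarrow> nat" assume e: "\<And>i. 0 < e i"
        define u :: "'m \<Rightarrow> complex" where "u = (\<lambda>i. (of_nat (e i) / of_nat (\<Sum>i\<in>UNIV. e i)) ^ p)"
        have "(u, \<lambda>i. of_nat (e i) / u i) \<in> char_variety ?I"
          unfolding char_variety_def u_def using psymbol_on_torus[OF A A0 B _ e] by auto
        moreover have "u i \<noteq> 0" for i
        proof -
          have "(\<Sum>i\<in>UNIV. e i) \<noteq> 0" using e by (auto simp: sum_eq_0_iff)
          then have "(of_nat (\<Sum>i\<in>UNIV. e i) :: complex) \<noteq> 0" unfolding of_nat_eq_0_iff .
          then show ?thesis using e[of i] by (simp add: u_def)
        qed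
        then have "(\<lambda>i. of_nat (e i) / u i) \<noteq> (\<lambda>_. 0)" using e by (auto simp: fun_eq_iff)
        ultimately have "u \<in> ?Ch" by force
        with g have "peval g u = 0" by (rule bspec)
        then show "peval g (\<lambda>i. (of_nat (e i) / of_nat (\<Sum>i\<in>UNIV. e i)) ^ p) = 0"
          by (simp only: u_def)
      qed
      then show ?thesis by (auto simp: sing_locus_def zariski_closure_def)
    qed
  qed
  show "\<exists>q::'m cpoly. (\<forall>x. peval q x = Rfun p x) \<and> pdeg q = p ^ (CARD('m) - 1)"
    using peval_Rpoly_Rfun[OF p_pos] pdeg_Rpoly[OF p_pos] by blast
qed

end
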